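(* Consider the asynchronous best response dynamics $Z(t)$ described in the context, with an arbitrary (possibly random) initial configuration $Z(0)\in[0,1]^n$. Then, with probability one, $Z(t)$ converges to the set $$\mathcal Z^*=\{\mathbf{1}-\alpha[\pi]\sigma^2:\ 0<\alpha\le\alpha_*\},\qquad\alpha_*=\frac1{\max_i\pi_i\sigma_i^2},$$ i.e. the distance from $Z(t)$ to $\mathcal Z^*$ tends to $0$ as $t\to\infty$.
   Context: Let $n\ge1$ and $\mathcal V=\{1,\dots,n\}$. Let $P\in\mathbb{R}^{n\times n}$ be a row-stochastic, irreducible, aperiodic matrix (the graph on $\mathcal V$ with edge $(i,j)$ iff $P_{ij}>0$ is strongly connected and has gcd of cycle lengths $1$), and $\pi$ the unique probability vector with $P'\pi=\pi$. For $z\in[0,1]^n$ let $W(z)=(I-[z])P+[z]$ ($[z]$ the diagonal matrix with diagonal $z$); the limit $H(z)=\lim_{t\to\infty}W(z)^t$ exists and is row-stochastic. Let $\sigma_1^2,\dots,\sigma_n^2>0$, $\sigma^2=(\sigma_1^2,\dots,\sigma_n^2)'$. Agent $i$'s cost is $\upsilon_i(z)=\sum_jH_{ij}(z)^2\sigma_j^2$, and her best response set to $z_{-i}=(z_j)_{j\ne i}$ is $\mathcal B_i(z_{-i})=\arg\min_{z_i\in[0,1]}\upsilon_i(z_i,z_{-i})$ (it is always nonempty and is either a singleton or an interval). The asynchronous best response dynamics is the discrete-time Markov chain $Z(t)$ on $[0,1]^n$ in which, at each time $t=0,1,2,\dots$, an agent $k$ is chosen uniformly at random from $\mathcal V$ (independently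 over time), $Z_k(t+1)$ is drawn uniformly at random from $\mathcal B_k(Z_{-k}(t))$, and $Z_{-k}(t+1)=Z_{-k}(t)$. *)

theory Defs
  imports "HOL-Probability.Probability"
begin

type_synonym 'n mat = "real ^ 'n ^ 'n"

(* matrix power A^t *)
definition mpow :: "'n::finite mat \<Rightarrow> nat \<Rightarrow> 'n mat" where
  "mpow A t = ((\<lambda>B. B ** A) ^^ t) (mat 1)"

(* diagonal matrix [z] *)
definition diagm :: "real ^ 'n \<Rightarrow> 'n::finite mat" where
  "diagm z = (\<chi> i j. if i = j then z $ i else 0)"

definition row_stochastic :: "'n::finite mat \<Rightarrow> bool" where
  "row_stochastic P \<longleftrightarrow> (\<forall>i j. P $ i $ j \<ge> 0) \<and> (\<forall>i. (\<Sum>j\<in>UNIV. P $ i $ j) = 1)"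

(* edge relation of the graph associated with P *)
definition graph_of :: "'n::finite mat \<Rightarrow> ('n \<times> 'n) set" where
  "graph_of P = {(i, j). P $ i $ j > 0}"

definition irreducible_mat :: "'n::finite mat \<Rightarrow> bool" where
  "irreducible_mat P \<longleftrightarrow> (\<forall>i j. (i, j) \<in> (graph_of P)\<^sup>*)"

(* gcd of the lengths of the (closed walks = ) cycles of the graph is 1 *)
definition aperiodic_mat :: "'n::finite mat \<Rightarrow> bool" where
  "aperiodic_mat P \<longleftrightarrow> Gcd {k::nat. k > 0 \<and> (\<exists>i. (i, i) \<in> graph_of P ^^ k)} = 1"

definition W :: "'n::finite mat \<Rightarrow> real ^ 'n \<Rightarrow> 'n mat" where
  "W P z = (mat 1 - diagm z) ** P + diagm z"

definition H :: "'n::finite mat \<Rightarrow> real ^ 'n \<Rightarrow> 'n mat" where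
  "H P z = lim (\<lambda>t. mpow (W P z) t)"

(* cost of agent i *)
definition cost :: "'n::finite mat \<Rightarrow> real ^ 'n \<Rightarrow> 'n \<Rightarrow> real ^ 'n \<Rightarrow> real" where
  "cost P sigma2 i z = (\<Sum>j\<in>UNIV. (H P z $ i $ j)\<^sup>2 * sigma2 $ j)"

definition upd :: "real ^ 'n \<Rightarrow> 'n::finite \<Rightarrow> real \<Rightarrow> real ^ 'n" where
  "upd z i x = (\<chi> j. if j = i then x else z $ j)"

(* best response set of agent i (depends only on z_{-i}) *)
definition best_resp :: "'n::finite mat \<Rightarrow> real ^ 'n \<Rightarrow> 'n \<Rightarrow> real ^ 'n \<Rightarrow> real set" where
  "best_resp P sigma2 i z =
     {x \<in> {0..1}. \<forall>y\<in>{0..1}. cost P sigma2 i (upd z i x) \<le> cost P sigma2 i (upd z i y)}"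

(* one step: agent k revises; u uniform on [0,1] yields a uniform draw from the
   interval (or singleton) best_resp, via inf + u * (sup - inf) *)
definition br_step :: "'n::finite mat \<Rightarrow> real ^ 'n \<Rightarrow> real ^ 'n \<Rightarrow> 'n \<Rightarrow> real \<Rightarrow> real ^ 'n" where
  "br_step P sigma2 z k u =
     (let B = best_resp P sigma2 k z in upd z k (Inf B + u * (Sup B - Inf B)))"

primrec br_dyn :: "'n::finite mat \<Rightarrow> real ^ 'n \<Rightarrow> ('w \<Rightarrow> real ^ 'n) \<Rightarrow> (nat \<Rightarrow> 'w \<Rightarrow> 'n)
    \<Rightarrow> (nat \<Rightarrow> 'w \<Rightarrow> real) \<Rightarrow> nat \<Rightarrow> 'w \<Rightarrow> real ^ 'n" where
  "br_dyn P sigma2 Z0 K U 0 \<omega> = Z0 \<omega>"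
| "br_dyn P sigma2 Z0 K U (Suc t) \<omega> = br_step P sigma2 (br_dyn P sigma2 Z0 K U t \<omega>) (K t \<omega>) (U t \<omega>)"

definition alpha_star :: "real ^ 'n \<Rightarrow> real ^ 'n::finite \<Rightarrow> real" where
  "alpha_star pv sigma2 = 1 / Max (range (\<lambda>i. pv $ i * sigma2 $ i))"

definition Zstar :: "real ^ 'n \<Rightarrow> real ^ 'n::finite \<Rightarrow> (real ^ 'n) set" where
  "Zstar pv sigma2 = {(\<chi> i. 1 - \<alpha> * pv $ i * sigma2 $ i) | \<alpha>. 0 < \<alpha> \<and> \<alpha> \<le> alpha_star pv sigma2}"

end

theory Submission
  imports Defs
begin

text \<open>
  The argument is pathwise. Almost surely all \<open>U t\<close> lie in \<open>[0,1)\<close> and the word that lists every agent once,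
  by decreasing variance, occurs infinitely often in the sequence of activated agents.

  If somebody else is stubborn (\<open>z\<^sub>s = 1\<close>), then \<open>H\<^sub>i\<close> is the hitting distribution of the stubborn set, which does
  not depend on \<open>z\<^sub>i < 1\<close>; an agent whose variance is at least that of every stubborn agent therefore has \<open>0\<close> as
  a best response, and draws some \<open>z\<^sub>i < 1\<close>. Hence nobody is stubborn after the first occurrence of the word, nor
  ever again.

  From then on all rows of \<open>H\<close> are proportional to \<open>a\<^sub>j = \<pi>\<^sub>j / (1 - z\<^sub>j)\<close>, and in terms of the levels
  \<open>b\<^sub>j = a\<^sub>j \<sigma>\<^sub>j\<^sup>2\<close> a best response of \<open>k\<close> sets \<open>b\<^sub>k\<close> to the maximum of \<open>\<pi>\<^sub>k \<sigma>\<^sub>k\<^sup>2\<close> and the average of the other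
  \<open>b\<^sub>j\<close> with weights \<open>a\<^sub>j\<close>. So the largest level never increases, the smallest never decreases, and every
  occurrence of the word shrinks their difference by a fixed factor. The set \<open>Zstar pv sigma2\<close> consists of the
  configurations with equal levels.
\<close>

section \<open>Additive sets and oscillation\<close>

text \<open>The least positive difference \<open>d\<close> of two elements of \<open>R0\<close>
  divides all of \<open>R\<close>, so the gcd forces \<open>d = 1\<close>. Two consecutive elements
  \<open>n\<close> and \<open>n + 1\<close> then generate everything from \<open>n * n\<close>
  on.\<close>

lemma eventually_in_additive_set:
  fixes R :: "nat set"
  assumes add: "\<And>x y. x \<in> R \<Longrightarrow> y \<in> R \<Longrightarrow> x + y \<in> R" and gcd: "Gcd R = 1"
  obtains N where "\<And>n. n \<ge> N \<Longrightarrow> n \<in> R"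
proof -
  define R0 where "R0 = insert 0 R"
  have add0: "x + y \<in> R0" if "x \<in> R0" "y \<in> R0" for x y
    using that add by (auto simp: R0_def)
  have mult0: "q * x \<in> R0" if "x \<in> R0" for q x
  proof (induction q)
    case 0 then show ?case by (simp add: R0_def)
  next
    case (Suc q) then show ?case using add0[OF that Suc] by simp
  qed
  define Q where "Q d \<longleftrightarrow> d > 0 \<and> (\<exists>n\<in>R0. n + d \<in> R0)" for d
  have "\<not> R \<subseteq> {0}"
  proof
    assume "R \<subseteq> {0}"
    then have "Gcd R = 0" by (subst Gcd_0_iff) auto
    with gcd show False by simp
  qed
  then obtain x where "x \<in> R" "x > 0" by auto
  then have "Q x" by (auto simp: Q_def R0_def)
  define d where "d = (LEAST d. Q d)"
  have "Q d" unfolding d_def by (rule LeastI[of Q, OF \<open>Q x\<close>])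
  have d_least: "d \<le> e" if "Q e" for e unfolding d_def by (rule Least_le) (rule that)
  from \<open>Q d\<close> obtain n where d: "d > 0" "n \<in> R0" "n + d \<in> R0" by (auto simp: Q_def)
  have "d dvd r" if "r \<in> R" for r
  proof (rule ccontr)
    assume nd: "\<not> d dvd r"
    define q where "q = r div d"
    have r: "r = q * d + r mod d" by (simp add: q_def)
    have pos: "r mod d > 0" using nd by (simp add: dvd_eq_mod_eq_0)
    have lt: "r mod d < d" using d by simp
    have "r \<in> R0" using that by (simp add: R0_def)
    \<comment> \<open>As \<open>r = q * d + r mod d\<close>, the second element exceeds the first by
      \<open>d - r mod d\<close>, a positive difference smaller than \<open>d\<close>.\<close>
    then have "r + (q + 1) * n \<in> R0" "(q + 1) * (n + d) \<in> R0"
      using add0 mult0 d by blast+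
    moreover have "r + (q + 1) * n + (d - r mod d) = (q + 1) * (n + d)"
      using r lt by (simp add: algebra_simps)
    ultimately have "Q (d - r mod d)"
      unfolding Q_def using lt by (metis zero_less_diff)
    from d_least[OF this] pos lt show False by simp
  qed
  then have "d dvd Gcd R" by (rule Gcd_greatest)
  with gcd have "d = 1" by simp
  have ge: "m \<in> R0" if "m \<ge> n * n" for m
  proof (cases "n = 0")
    case True
    then show ?thesis using d \<open>d = 1\<close> mult0[of 1 m] by simp
  next
    case False
    define q r where "q = m div n" and "r = m mod n"
    have m: "m = q * n + r" by (simp add: q_def r_def)
    have "n \<le> q" unfolding q_def using that False
      by (metis div_le_mono nonzero_mult_div_cancel_right)
    moreover have "r < n" using False by (simp add: r_def)
    ultimately have "r \<le> q" by simp
    then obtain c where "q = c + r" by (metis le_add_diff_inverse2)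
    then have "m = c * n + r * (n + 1)" using m by (simp add: algebra_simps)
    then show ?thesis using add0 mult0 d \<open>d = 1\<close> by metis
  qed
  \<comment> \<open>Starting at \<open>Suc (n * n)\<close> keeps \<open>m\<close> positive: 0 was
    only adjoined to form \<open>R0\<close> and need not lie in \<open>R\<close>.\<close>
  show thesis
  proof (rule that[of "Suc (n * n)"])
    fix m assume "Suc (n * n) \<le> m"
    then show "m \<in> R" using ge[of m] by (auto simp: R0_def)
  qed
qed

section \<open>Oscillation of a finite family and decay to zero\<close>

definition osc :: "('a::finite \<Rightarrow> real) \<Rightarrow> real" where
  "osc f = Max (range f) - Min (range f)"

lemma osc_le: "(\<And>i. l \<le> f i) \<Longrightarrow> (\<And>i. f i \<le> u) \<Longrightarrow> osc f \<le> u - l"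
  unfolding osc_def by (intro diff_mono) (auto intro!: Max.boundedI Min.boundedI)

lemma abs_diff_le_osc:
  assumes "Min (range f) \<le> c" "c \<le> Max (range f)"
  shows "\<bar>f i - c\<bar> \<le> osc f"
proof -
  have "Min (range f) \<le> f i" "f i \<le> Max (range f)" by auto
  with assms show ?thesis unfolding osc_def by linarith
qed

lemma osc_nonneg: "0 \<le> osc f"
  using abs_diff_le_osc[of f "f i" i for i] by (auto simp: osc_def)

text \<open>The limit \<open>L\<close> satisfies \<open>L \<le> q * L\<close>, which leaves only 0.
  Contraction at infinitely many times is what recurrences of the word provide; for matrix powers it
  holds at every time.\<close>

lemma contracting_decseq_tendsto_0:
  fixes D :: "nat \<Rightarrow> real"
  assumes dec: "decseq D" and nn: "\<And>t. 0 \<le> D t" and q: "q < 1"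
    and contr: "\<exists>\<^sub>\<infinity>t. D (t + N) \<le> q * D t"
  shows "D \<longlonglongrightarrow> 0"
proof -
  obtain L where L: "D \<longlonglongrightarrow> L" "\<And>t. L \<le> D t"
    using decseq_convergent[OF dec] nn by metis
  have "0 \<le> L" using L(1) nn by (intro LIMSEQ_le_const) auto
  have "L \<le> q * L"
  proof (rule ccontr)
    assume "\<not> L \<le> q * L"
    moreover have "(\<lambda>t. q * D t) \<longlonglongrightarrow> q * L" using L(1) by (intro tendsto_intros)
    ultimately have "eventually (\<lambda>t. q * D t < L) sequentially"
      by (auto intro: order_tendstoD)
    then have "eventually (\<lambda>t. \<not> D (t + N) \<le> q * D t) sequentially"
      by eventually_elim (use L(2) in \<open>meson not_le less_le_trans\<close>)
    with contr show False
      unfolding frequently_def cofinite_eq_sequentially by simp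
  qed
  then have "(1 - q) * L \<le> 0" by (simp add: algebra_simps)
  with \<open>0 \<le> L\<close> q have "L = 0" by (simp add: mult_le_0_iff)
  with L show ?thesis by simp
qed

section \<open>Powers of stochastic matrices\<close>

lemma matrix_mult_nth: "(A ** B) $ i $ j = (\<Sum>k\<in>UNIV. A $ i $ k * B $ k $ j)"
  by (simp add: matrix_matrix_mult_def)

lemma mpow_0 [simp]: "mpow A 0 = mat 1"
  by (simp add: mpow_def)

lemma mpow_Suc: "mpow A (Suc t) = mpow A t ** A"
  by (simp add: mpow_def)

lemma mpow_add: "mpow A (s + t) = mpow A s ** mpow A t"
  by (induction t) (simp_all add: mpow_Suc matrix_mul_assoc)

lemma mpow_Suc_left: "mpow A (Suc t) = A ** mpow A t"
  using mpow_add[of A 1 t] by (simp add: mpow_Suc)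

lemma row_stochastic_mult:
  assumes "row_stochastic A" "row_stochastic B"
  shows "row_stochastic (A ** B)"
proof -
  have "(\<Sum>j\<in>UNIV. (A ** B) $ i $ j) = 1" for i
  proof -
    have "(\<Sum>j\<in>UNIV. (A ** B) $ i $ j) = (\<Sum>k\<in>UNIV. \<Sum>j\<in>UNIV. A $ i $ k * B $ k $ j)"
      by (simp add: matrix_mult_nth) (rule sum.swap)
    also have "\<dots> = 1" using assms by (simp add: row_stochastic_def flip: sum_distrib_left)
    finally show ?thesis .
  qed
  with assms show ?thesis
    by (auto simp: row_stochastic_def matrix_mult_nth intro!: sum_nonneg)
qed

lemma row_stochastic_mpow: "row_stochastic A \<Longrightarrow> row_stochastic (mpow A t)"
proof (induction t)
  case 0
  then show ?case by (auto simp: row_stochastic_def mat_def)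
next
  case (Suc t)
  then show ?case by (simp add: mpow_Suc row_stochastic_mult)
qed

lemma row_stochastic_le_1: "row_stochastic A \<Longrightarrow> A $ i $ j \<le> 1"
  unfolding row_stochastic_def
  by (metis UNIV_I finite_class.finite_UNIV member_le_sum)

lemma mpow_pos_if_walk:
  assumes "row_stochastic A" "(i, j) \<in> graph_of A ^^ t"
  shows "mpow A t $ i $ j > 0"
  using assms(2)
proof (induction t arbitrary: j)
  case 0
  then show ?case by (simp add: mat_def)
next
  case (Suc t)
  then obtain k where k: "(i, k) \<in> graph_of A ^^ t" "(k, j) \<in> graph_of A" by auto
  have "0 < mpow A t $ i $ k * A $ k $ j"
    using Suc.IH[OF k(1)] k(2) by (simp add: graph_of_def)
  also have "\<dots> \<le> mpow A (Suc t) $ i $ j"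
    unfolding mpow_Suc matrix_mult_nth
    using row_stochastic_mpow[OF assms(1), of t] assms(1)
    by (intro member_le_sum[of k UNIV "\<lambda>k. mpow A t $ i $ k * A $ k $ j"])
       (auto simp: row_stochastic_def)
  finally show ?case .
qed

section \<open>Contraction under averaging and convergence of powers\<close>

lemma weighted_average_bounds:
  fixes y :: "'a::finite \<Rightarrow> real"
  assumes "row_stochastic A" "\<And>k. l \<le> y k" "\<And>k. y k \<le> u"
  shows "l \<le> (\<Sum>k\<in>UNIV. A $ i $ k * y k)" "(\<Sum>k\<in>UNIV. A $ i $ k * y k) \<le> u"
proof -
  have 1: "(\<Sum>k\<in>UNIV. A $ i $ k * c) = c" for c
    using assms(1) by (simp add: row_stochastic_def flip: sum_distrib_right)
  have "(\<Sum>k\<in>UNIV. A $ i $ k * l) \<le> (\<Sum>k\<in>UNIV. A $ i $ k * y k)"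
       "(\<Sum>k\<in>UNIV. A $ i $ k * y k) \<le> (\<Sum>k\<in>UNIV. A $ i $ k * u)"
    using assms by (auto intro!: sum_mono mult_left_mono simp: row_stochastic_def)
  then show "l \<le> (\<Sum>k\<in>UNIV. A $ i $ k * y k)" "(\<Sum>k\<in>UNIV. A $ i $ k * y k) \<le> u"
    by (simp_all add: 1)
qed

lemma osc_average_le:
  assumes "row_stochastic A"
  shows "osc (\<lambda>i. \<Sum>k\<in>UNIV. A $ i $ k * y k) \<le> osc y"
  unfolding osc_def[of y]
  by (rule osc_le; rule weighted_average_bounds[OF assms, of "Min (range y)" y "Max (range y)"]) auto

text \<open>Doeblin's argument: every average is moved from either extreme by at least the fraction
  \<open>\<epsilon>\<close> of the way towards \<open>y s\<close>, and the two gains add up to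
  \<open>\<epsilon>\<close> times the oscillation.\<close>

lemma osc_average_contracts:
  assumes A: "row_stochastic A" and col: "\<And>i. \<epsilon> \<le> A $ i $ s"
  shows "osc (\<lambda>i. \<Sum>k\<in>UNIV. A $ i $ k * y k) \<le> (1 - \<epsilon>) * osc y"
proof -
  define l u where "l = Min (range y)" and "u = Max (range y)"
  have lu: "l \<le> y k" "y k \<le> u" for k by (auto simp: l_def u_def)
  have 1: "(\<Sum>k\<in>UNIV. A $ i $ k * c) = c" for c i
    using A by (simp add: row_stochastic_def flip: sum_distrib_right)
  have nn: "0 \<le> A $ i $ k" for i k using A by (simp add: row_stochastic_def)
  have lower: "l + \<epsilon> * (y s - l) \<le> (\<Sum>k\<in>UNIV. A $ i $ k * y k)" for i
  proof -
    have "\<epsilon> * (y s - l) \<le> A $ i $ s * (y s - l)" using col lu by (simp add: mult_right_mono)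
    also have "\<dots> \<le> (\<Sum>k\<in>UNIV. A $ i $ k * (y k - l))"
      by (rule member_le_sum[of s UNIV "\<lambda>k. A $ i $ k * (y k - l)"]) (use nn lu in auto)
    also have "\<dots> = (\<Sum>k\<in>UNIV. A $ i $ k * y k) - l"
      by (simp add: right_diff_distrib sum_subtractf 1)
    finally show ?thesis by simp
  qed
  have upper: "(\<Sum>k\<in>UNIV. A $ i $ k * y k) \<le> u - \<epsilon> * (u - y s)" for i
  proof -
    have "\<epsilon> * (u - y s) \<le> A $ i $ s * (u - y s)" using col lu by (simp add: mult_right_mono)
    also have "\<dots> \<le> (\<Sum>k\<in>UNIV. A $ i $ k * (u - y k))"
      by (rule member_le_sum[of s UNIV "\<lambda>k. A $ i $ k * (u - y k)"]) (use nn lu in auto)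
    also have "\<dots> = u - (\<Sum>k\<in>UNIV. A $ i $ k * y k)"
      by (simp add: right_diff_distrib sum_subtractf 1)
    finally show ?thesis by simp
  qed
  have "osc (\<lambda>i. \<Sum>k\<in>UNIV. A $ i $ k * y k) \<le> (u - \<epsilon> * (u - y s)) - (l + \<epsilon> * (y s - l))"
    by (rule osc_le) (use lower upper in auto)
  also have "\<dots> = (1 - \<epsilon>) * osc y" by (simp add: osc_def l_def u_def algebra_simps)
  finally show ?thesis .
qed

text \<open>Column \<open>s\<close> of \<open>mpow A N\<close> is bounded below by some
  \<open>\<epsilon> > 0\<close>, so each column of \<open>mpow A t\<close> becomes constant in the
  row index as \<open>t\<close> grows. Its average under the stationary \<open>h\<close> is always
  \<open>h j\<close>, which identifies the constant.\<close>

lemma mpow_tendsto_stationary: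
  fixes A :: "'n::finite mat"
  assumes A: "row_stochastic A" and walk: "\<And>i. (i, s) \<in> graph_of A ^^ N"
    and h_nn: "\<And>j. 0 \<le> h j" and h_sum: "(\<Sum>j\<in>UNIV. h j) = 1"
    and h_stat: "\<And>j. (\<Sum>i\<in>UNIV. h i * A $ i $ j) = h j"
  shows "(mpow A) \<longlonglongrightarrow> (\<chi> i j. h j)"
proof -
  define \<epsilon> where "\<epsilon> = Min (range (\<lambda>i. mpow A N $ i $ s))"
  have \<epsilon>: "\<epsilon> > 0" "\<And>i. \<epsilon> \<le> mpow A N $ i $ s"
    unfolding \<epsilon>_def using mpow_pos_if_walk[OF A walk] by auto
  have stat: "(\<Sum>i\<in>UNIV. h i * mpow A t $ i $ j) = h j" for t j
  proof (induction t arbitrary: j)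
    case 0 then show ?case by (simp add: mat_def if_distrib cong: if_cong)
  next
    case (Suc t)
    have "(\<Sum>i\<in>UNIV. h i * mpow A (Suc t) $ i $ j)
        = (\<Sum>k\<in>UNIV. (\<Sum>i\<in>UNIV. h i * A $ i $ k) * mpow A t $ k $ j)"
      by (simp add: mpow_Suc_left matrix_mult_nth sum_distrib_left sum_distrib_right mult.assoc)
         (rule sum.swap)
    then show ?case by (simp add: h_stat Suc)
  qed
  have "(\<lambda>t. mpow A t $ i $ j) \<longlonglongrightarrow> h j" for i j
  proof -
    define D where "D t = osc (\<lambda>i. mpow A t $ i $ j)" for t
    have D_Suc: "D (Suc t) \<le> D t" for t
      unfolding D_def mpow_Suc_left matrix_mult_nth by (rule osc_average_le[OF A])
    have D_N: "D (t + N) \<le> (1 - \<epsilon>) * D t" for t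
      unfolding D_def add.commute[of t N] mpow_add matrix_mult_nth
      by (rule osc_average_contracts[OF row_stochastic_mpow[OF A] \<epsilon>(2)])
    have D0: "D \<longlonglongrightarrow> 0"
      by (rule contracting_decseq_tendsto_0[where q = "1 - \<epsilon>" and N = N])
         (use D_Suc D_N \<epsilon> in \<open>auto simp: decseq_Suc_iff D_def osc_nonneg\<close>)
    have "\<bar>mpow A t $ i $ j - h j\<bar> \<le> D t" for t
      unfolding D_def
    proof (rule abs_diff_le_osc)
      let ?f = "\<lambda>i. mpow A t $ i $ j"
      have "(\<Sum>i\<in>UNIV. h i * Min (range ?f)) \<le> (\<Sum>i\<in>UNIV. h i * mpow A t $ i $ j)"
           "(\<Sum>i\<in>UNIV. h i * mpow A t $ i $ j) \<le> (\<Sum>i\<in>UNIV. h i * Max (range ?f))"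
        using h_nn by (auto intro!: sum_mono mult_left_mono)
      then show "Min (range ?f) \<le> h j" "h j \<le> Max (range ?f)"
        by (simp_all add: stat h_sum flip: sum_distrib_right)
    qed
    then have "(\<lambda>t. mpow A t $ i $ j - h j) \<longlonglongrightarrow> 0"
      by (intro Lim_null_comparison[OF _ D0]) (auto simp: always_eventually)
    then show ?thesis by (simp add: LIM_zero_iff)
  qed
  then show ?thesis by (intro vec_tendstoI) simp
qed

lemma mpow_limit_harmonic:
  assumes "(mpow A) \<longlonglongrightarrow> L"
  shows "A ** L = L"
proof -
  have "(\<lambda>t. A ** mpow A t) \<longlonglongrightarrow> A ** L"
    by (intro vec_tendstoI, unfold matrix_mult_nth)
       (intro tendsto_sum tendsto_mult tendsto_const tendsto_vec_nth assms)
  moreover have "(\<lambda>t. A ** mpow A t) \<longlonglongrightarrow> L"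
    using LIMSEQ_Suc[OF assms] by (simp add: mpow_Suc_left)
  ultimately show ?thesis by (rule LIMSEQ_unique)
qed

lemma mpow_limit_row_stochastic:
  assumes "row_stochastic A" "(mpow A) \<longlonglongrightarrow> L"
  shows "row_stochastic L"
proof -
  have e: "(\<lambda>t. mpow A t $ i $ j) \<longlonglongrightarrow> L $ i $ j" for i j
    by (intro tendsto_intros assms)
  have "0 \<le> L $ i $ j" for i j
    by (rule LIMSEQ_le_const[OF e]) (use row_stochastic_mpow[OF assms(1)] in \<open>auto simp: row_stochastic_def\<close>)
  moreover have "(\<lambda>t. \<Sum>j\<in>UNIV. mpow A t $ i $ j) \<longlonglongrightarrow> (\<Sum>j\<in>UNIV. L $ i $ j)" for i
    by (intro tendsto_sum e)
  then have "(\<Sum>j\<in>UNIV. L $ i $ j) = 1" for i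
    using row_stochastic_mpow[OF assms(1)] by (simp add: row_stochastic_def LIMSEQ_const_iff)
  ultimately show ?thesis by (simp add: row_stochastic_def)
qed

section \<open>Maximum principle and absorbing chains\<close>

lemma mpow_absorbing_row:
  assumes "\<And>j. A $ s $ j = (if s = j then 1 else 0)"
  shows "mpow A t $ s $ j = (if s = j then 1 else 0)"
proof (induction t arbitrary: j)
  case 0 then show ?case by (simp add: mat_def)
next
  case (Suc t)
  then show ?case by (simp add: mpow_Suc_left matrix_mult_nth assms if_distrib[of "\<lambda>x. x * _"] cong: if_cong)
qed

text \<open>Maximum principle: an average of values at most \<open>y i\<close> can equal
  \<open>y i\<close> only if no positively weighted value lies below it, so the maximum travels
  along edges.\<close>

lemma harmonic_max_propagates:
  assumes A: "row_stochastic A" and harm: "\<And>i. (\<Sum>k\<in>UNIV. A $ i $ k * y k) = y i"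
    and "(i, j) \<in> (graph_of A)\<^sup>*" and max: "\<And>k. y k \<le> y i"
  shows "y j = y i"
  using assms(3)
proof (induction rule: rtrancl_induct)
  case (step j l)
  show ?case
  proof (rule ccontr)
    assume "y l \<noteq> y i"
    with max[of l] have "y l < y i" by simp
    then have "A $ j $ l * y l < A $ j $ l * y i" using step(2) by (simp add: graph_of_def)
    then have "(\<Sum>k\<in>UNIV. A $ j $ k * y k) < (\<Sum>k\<in>UNIV. A $ j $ k * y i)"
      using A max by (intro sum_strict_mono_ex1) (auto simp: row_stochastic_def intro: mult_left_mono)
    also have "\<dots> = y i" using A by (simp add: row_stochastic_def flip: sum_distrib_right)
    finally show False using harm[of j] step.IH by simp
  qed
qed simp

text \<open>The maximum is attained somewhere and travels along a walk into \<open>S\<close>. This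
  serves both to show that an absorbing chain loses all its transient mass and to get uniqueness for
  given boundary values.\<close>

lemma harmonic_le_0:
  fixes y :: "'n::finite \<Rightarrow> real"
  assumes "row_stochastic A" "\<And>i. (\<Sum>k\<in>UNIV. A $ i $ k * y k) = y i"
    and reach: "\<And>i. \<exists>s\<in>S. (i, s) \<in> (graph_of A)\<^sup>*" and "\<And>s. s \<in> S \<Longrightarrow> y s \<le> 0"
  shows "y i \<le> 0"
proof -
  have "Max (range y) \<in> range y" by (rule Max_in) auto
  then obtain m where m: "Max (range y) = y m" by (elim rangeE)
  then have max: "y k \<le> y m" for k by (metis Max_ge finite finite_imageI rangeI)
  obtain s where "s \<in> S" "(m, s) \<in> (graph_of A)\<^sup>*" using reach by blast
  then have "y m \<le> 0" using harmonic_max_propagates[OF assms(1,2) _ max] assms(4) by metis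
  with max[of i] show ?thesis by simp
qed

text \<open>Columns in \<open>S\<close> increase with \<open>t\<close>, hence converge. The mass
  \<open>r t i\<close> still outside \<open>S\<close> therefore converges too; its limit is harmonic
  and vanishes on \<open>S\<close>, so it is 0, and this squeezes all other columns to 0.\<close>

lemma mpow_tendsto_absorbing:
  fixes A :: "'n::finite mat"
  assumes A: "row_stochastic A" and abs: "\<And>s j. s \<in> S \<Longrightarrow> A $ s $ j = (if s = j then 1 else 0)"
    and reach: "\<And>i. \<exists>s\<in>S. (i, s) \<in> (graph_of A)\<^sup>*"
  obtains L where "(mpow A) \<longlonglongrightarrow> L" "\<And>i j. j \<notin> S \<Longrightarrow> L $ i $ j = 0"
proof -
  have st: "row_stochastic (mpow A t)" for t by (rule row_stochastic_mpow[OF A])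
  have nn: "0 \<le> mpow A t $ i $ j" for t i j using st by (simp add: row_stochastic_def)
  define l where "l i s = lim (\<lambda>t. mpow A t $ i $ s)" for i s
  have l: "(\<lambda>t. mpow A t $ i $ s) \<longlonglongrightarrow> l i s" if "s \<in> S" for i s
  proof -
    have "incseq (\<lambda>t. mpow A t $ i $ s)"
    proof (rule incseq_SucI)
      fix t
      have "mpow A t $ i $ s = mpow A t $ i $ s * A $ s $ s" using abs[OF that] by simp
      also have "\<dots> \<le> mpow A (Suc t) $ i $ s"
        unfolding mpow_Suc matrix_mult_nth
        by (rule member_le_sum[of s UNIV "\<lambda>k. mpow A t $ i $ k * A $ k $ s"])
           (use nn A in \<open>auto simp: row_stochastic_def\<close>)
      finally show "mpow A t $ i $ s \<le> mpow A (Suc t) $ i $ s" .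
    qed
    then have "convergent (\<lambda>t. mpow A t $ i $ s)"
      by (metis convergentI incseq_convergent row_stochastic_le_1[OF st])
    then show ?thesis by (simp add: l_def convergent_LIMSEQ_iff)
  qed
  define y where "y i = 1 - (\<Sum>s\<in>S. l i s)" for i
  define r where "r t i = (\<Sum>j\<in>-S. mpow A t $ i $ j)" for t i
  have r_eq: "r t i = 1 - (\<Sum>s\<in>S. mpow A t $ i $ s)" for t i
  proof -
    have "(\<Sum>j\<in>UNIV. mpow A t $ i $ j) = (\<Sum>s\<in>S. mpow A t $ i $ s) + (\<Sum>j\<in>-S. mpow A t $ i $ j)"
      using sum.union_disjoint[of S "-S" "\<lambda>j. mpow A t $ i $ j"] by (simp add: Compl_partition)
    with st show ?thesis by (simp add: r_def row_stochastic_def)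
  qed
  have r_lim: "(\<lambda>t. r t i) \<longlonglongrightarrow> y i" for i
    unfolding r_eq y_def by (intro tendsto_intros l)
  have "y i \<le> 0" for i
  proof (rule harmonic_le_0[OF A _ reach])
    fix i
    have "(\<lambda>t. \<Sum>k\<in>UNIV. A $ i $ k * r t k) \<longlonglongrightarrow> (\<Sum>k\<in>UNIV. A $ i $ k * y k)"
      by (intro tendsto_intros r_lim)
    moreover have "(\<Sum>k\<in>UNIV. A $ i $ k * r t k) = r (Suc t) i" for t
      unfolding r_def mpow_Suc_left matrix_mult_nth sum_distrib_left by (rule sum.swap)
    ultimately show "(\<Sum>k\<in>UNIV. A $ i $ k * y k) = y i"
      using LIMSEQ_Suc[OF r_lim[of i]] by (simp add: LIMSEQ_unique)
  next
    fix s assume "s \<in> S"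
    have "r t s = 0" for t
      unfolding r_def using \<open>s \<in> S\<close> by (intro sum.neutral) (auto simp: mpow_absorbing_row[of A s, OF abs])
    with r_lim[of s] show "y s \<le> 0" by (simp add: LIMSEQ_const_iff)
  qed
  moreover have "0 \<le> y i" for i
    by (rule LIMSEQ_le_const[OF r_lim[of i]]) (auto simp: r_def nn intro!: sum_nonneg)
  ultimately have "y i = 0" for i by (simp add: order_antisym)
  then have r0: "(\<lambda>t. r t i) \<longlonglongrightarrow> 0" for i using r_lim[of i] by simp
  have z: "(\<lambda>t. mpow A t $ i $ j) \<longlonglongrightarrow> 0" if "j \<notin> S" for i j
  proof (rule Lim_null_comparison[OF _ r0[of i]], rule always_eventually, rule allI)
    fix t
    show "norm (mpow A t $ i $ j) \<le> r t i"
      unfolding r_def using nn that by (auto intro!: member_le_sum[of j "-S" "\<lambda>j. mpow A t $ i $ j"])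
  qed
  show thesis
    by (rule that[of "\<chi> i j. if j \<in> S then l i j else 0"]) (auto intro!: vec_tendstoI simp: l z)
qed

text \<open>The gcd condition concerns cycles anywhere, whereas padding needs closed walks at
  \<open>s\<close>; the lengths of those form an additive set whose gcd is again 1. Each walk
  \<open>d i\<close> to \<open>s\<close> is then prolonged by a closed walk at \<open>s\<close> to a
  common length.\<close>

lemma common_walk_length:
  fixes G :: "('n::finite \<times> 'n) set"
  assumes conn: "\<And>i j. (i, j) \<in> G\<^sup>*" and gcd: "Gcd {k. k > 0 \<and> (\<exists>i. (i, i) \<in> G ^^ k)} = 1"
  obtains N where "\<And>i. (i, s) \<in> G ^^ N"
proof -
  have comp: "(i, k) \<in> G ^^ (m + n)" if "(i, j) \<in> G ^^ m" "(j, k) \<in> G ^^ n" for i j k m n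
    using that by (auto simp: relpow_add)
  have walk: "\<exists>n. (i, j) \<in> G ^^ n" for i j using conn rtrancl_power by metis
  define R where "R = {k. k > 0 \<and> (s, s) \<in> G ^^ k}"
  have "Gcd R dvd k" if "k > 0" "(i, i) \<in> G ^^ k" for k i
  proof -
    obtain a b where ab: "(s, i) \<in> G ^^ a" "(i, s) \<in> G ^^ b" using walk by metis
    \<comment> \<open>Running through the cycle at \<open>i\<close> twice or once gives closed walks
      at \<open>s\<close> whose lengths differ by \<open>k\<close>.\<close>
    have "a + (k + (k + b)) \<in> R" "a + (k + b) \<in> R"
      using that ab unfolding R_def by (auto intro: comp)
    then have "Gcd R dvd (a + (k + (k + b))) - (a + (k + b))"
      by (intro dvd_diff_nat) auto
    then show ?thesis by simp
  qed
  then have "Gcd R dvd Gcd {k. k > 0 \<and> (\<exists>i. (i, i) \<in> G ^^ k)}" by (intro Gcd_greatest) auto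
  then have "Gcd R = 1" by (simp add: gcd)
  moreover have "x + y \<in> R" if "x \<in> R" "y \<in> R" for x y using that by (auto simp: R_def intro: comp)
  ultimately obtain N where N: "\<And>n. n \<ge> N \<Longrightarrow> n \<in> R" using eventually_in_additive_set by metis
  have "\<exists>d. \<forall>i. (i, s) \<in> G ^^ d i" using walk by (intro choice) blast
  then obtain d where d: "\<And>i. (i, s) \<in> G ^^ d i" by blast
  show thesis
  proof (rule that)
    fix i
    have "d i \<le> Max (range d)" by simp
    then have "d i + (Max (range d) + N - d i) = Max (range d) + N" by linarith
    moreover have "Max (range d) + N - d i \<in> R" using \<open>d i \<le> Max (range d)\<close> by (intro N) linarith
    ultimately show "(i, s) \<in> G ^^ (Max (range d) + N)"
      using comp[OF d[of i], of s "Max (range d) + N - d i"] by (simp add: R_def)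
  qed
qed

section \<open>Equilibrium weights and best responses\<close>

definition cube :: "(real ^ 'n) set" where
  "cube = {z. \<forall>i. 0 \<le> z $ i \<and> z $ i \<le> 1}"

lemma upd_nth [simp]: "upd z i x $ j = (if j = i then x else z $ j)"
  by (simp add: upd_def)

lemma upd_in_cube: "z \<in> cube \<Longrightarrow> 0 \<le> x \<Longrightarrow> x \<le> 1 \<Longrightarrow> upd z i x \<in> cube"
  by (simp add: cube_def)

lemma W_nth: "W P z $ i $ j = (1 - z $ i) * P $ i $ j + (if i = j then z $ i else 0)"
proof -
  have "((mat 1 - diagm z) ** P) $ i $ j = (\<Sum>k\<in>UNIV. (if k = i then 1 - z $ i else 0) * P $ k $ j)"
    unfolding matrix_mult_nth by (intro sum.cong) (auto simp: mat_def diagm_def)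
  also have "\<dots> = (1 - z $ i) * P $ i $ j"
    by (simp add: if_distrib[of "\<lambda>x. x * _"] cong: if_cong)
  finally show ?thesis by (simp add: W_def diagm_def)
qed

lemma W_average:
  "(\<Sum>k\<in>UNIV. W P z $ i $ k * y k) = (1 - z $ i) * (\<Sum>k\<in>UNIV. P $ i $ k * y k) + z $ i * y i"
  by (simp add: W_nth distrib_right sum.distrib sum_distrib_left mult.assoc
      if_distrib[of "\<lambda>x. x * _"] cong: if_cong)

lemma row_stochastic_W:
  assumes "row_stochastic P" "z \<in> cube"
  shows "row_stochastic (W P z)"
  using assms W_average[of P z _ "\<lambda>_. 1"] by (auto simp: row_stochastic_def cube_def W_nth)

lemma graph_of_W:
  assumes "z \<in> cube" "z $ i < 1" "(i, j) \<in> graph_of P"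
  shows "(i, j) \<in> graph_of (W P z)"
  using assms by (auto simp: graph_of_def W_nth cube_def intro!: add_pos_nonneg)

lemma W_stubborn_row: "z $ s = 1 \<Longrightarrow> W P z $ s $ j = (if s = j then 1 else 0)"
  by (auto simp: W_nth)

text \<open>Completing the square around the unconstrained minimiser \<open>c\<close>.\<close>

lemma average_cost_identity:
  fixes S Q s a c :: real
  assumes "S > 0" "Q > 0" "s > 0" "a > 0" and c: "c = Q / (S * s)"
  shows "(Q + a\<^sup>2 * s) / (S + a)\<^sup>2 = s / (S + c) * (c + S * ((a - c) / (S + a))\<^sup>2)"
proof -
  have "c > 0" using assms by simp
  have Q: "Q = c * S * s" using assms by simp
  have "S + a > 0" "S + c > 0" using \<open>c > 0\<close> assms(1,4) by auto
  then show ?thesis unfolding Q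
    by (simp add: divide_simps) algebra
qed

locale opinion_game =
  fixes P :: "'n::finite mat" and pv sigma2 :: "real ^ 'n"
  assumes P_stoch: "row_stochastic P" and P_irred: "irreducible_mat P" and P_aper: "aperiodic_mat P"
    and pv_nonneg: "\<And>i. 0 \<le> pv $ i" and pv_sum: "(\<Sum>i\<in>UNIV. pv $ i) = 1"
    and pv_stat: "transpose P *v pv = pv" and sigma_pos: "\<And>i. 0 < sigma2 $ i"
begin

section \<open>The invariant vector, and \<open>H\<close> when nobody is stubborn\<close>

lemma pv_balance: "(\<Sum>i\<in>UNIV. pv $ i * P $ i $ j) = pv $ j"
proof -
  have "(transpose P *v pv) $ j = (\<Sum>i\<in>UNIV. pv $ i * P $ i $ j)"
    by (simp add: matrix_vector_mult_def transpose_def mult.commute del: transpose_matrix_vector)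
  then show ?thesis by (simp only: pv_stat)
qed

lemma pv_pos: "0 < pv $ i"
proof -
  obtain j where j: "pv $ j > 0"
    using pv_sum pv_nonneg by (metis less_eq_real_def sum.neutral zero_neq_one)
  have "(j, i) \<in> (graph_of P)\<^sup>*" using P_irred by (simp add: irreducible_mat_def)
  then show ?thesis
  proof (induction rule: rtrancl_induct)
    case base then show ?case by (rule j)
  next
    case (step k l)
    then have "0 < pv $ k * P $ k $ l" by (simp add: graph_of_def)
    also have "\<dots> \<le> (\<Sum>k\<in>UNIV. pv $ k * P $ k $ l)"
      by (rule member_le_sum[of k UNIV "\<lambda>k. pv $ k * P $ k $ l"])
         (use P_stoch pv_nonneg in \<open>auto simp: row_stochastic_def\<close>)
    finally show ?case by (simp add: pv_balance)
  qed
qed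

text \<open>The invariant vector of \<open>W P z\<close>, up to normalisation, when nobody is
  stubborn: staying put with probability \<open>z $ j\<close> lengthens each visit to
  \<open>j\<close> by the factor \<open>1 / (1 - z $ j)\<close> on average.\<close>

definition mass :: "real ^ 'n \<Rightarrow> 'n \<Rightarrow> real" where
  "mass z j = pv $ j / (1 - z $ j)"

lemma mass_pos: "z $ j < 1 \<Longrightarrow> 0 < mass z j"
  by (simp add: mass_def pv_pos)

lemma H_nonstubborn:
  assumes z: "z \<in> cube" and lt: "\<And>i. z $ i < 1"
  shows "H P z $ i $ j = mass z j / (\<Sum>k\<in>UNIV. mass z k)"
proof -
  have "Gcd {k. k > 0 \<and> (\<exists>i. (i, i) \<in> graph_of P ^^ k)} = 1"
    using P_aper by (simp add: aperiodic_mat_def)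
  \<comment> \<open>\<open>undefined\<close> is merely some fixed vertex, taken as the common
    endpoint of the walks.\<close>
  then obtain N where N: "\<And>i. (i, undefined) \<in> graph_of P ^^ N"
    using common_walk_length[of "graph_of P" undefined] P_irred by (auto simp: irreducible_mat_def)
  have "graph_of P \<subseteq> graph_of (W P z)" using graph_of_W[OF z lt] by auto
  then have "graph_of P ^^ N \<subseteq> graph_of (W P z) ^^ N" by (induction N) (auto simp: relcomp_unfold)
  then have N': "(i, undefined) \<in> graph_of (W P z) ^^ N" for i using N by blast
  define T where "T = (\<Sum>k\<in>UNIV. mass z k)"
  have "T > 0" unfolding T_def by (intro sum_pos) (auto simp: mass_pos lt)
  have "mpow (W P z) \<longlonglongrightarrow> (\<chi> i j. mass z j / T)"
  proof (rule mpow_tendsto_stationary[OF row_stochastic_W[OF P_stoch z] N'])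
    show "0 \<le> mass z j / T" for j using \<open>T > 0\<close> mass_pos[OF lt, of j] by simp
    show "(\<Sum>j\<in>UNIV. mass z j / T) = 1" using \<open>T > 0\<close> by (simp add: T_def flip: sum_divide_distrib)
    fix j
    \<comment> \<open>The factor \<open>1 - z $ i\<close> cancels against the mass, so invariance
      under \<open>W P z\<close> reduces to that of \<open>pv\<close> under
      \<open>P\<close>.\<close>
    have e: "mass z i * W P z $ i $ j = pv $ i * P $ i $ j + (if i = j then mass z i * z $ i else 0)" for i
    proof -
      have "mass z i * (1 - z $ i) = pv $ i" using lt[of i] by (simp add: mass_def)
      then show ?thesis by (simp add: W_nth distrib_left flip: mult.assoc)
    qed
    have "(\<Sum>i\<in>UNIV. mass z i * W P z $ i $ j) = pv $ j + mass z j * z $ j"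
      unfolding e sum.distrib pv_balance by simp
    also have "\<dots> = mass z j" using lt[of j] by (simp add: mass_def field_simps)
    finally show "(\<Sum>i\<in>UNIV. mass z i / T * W P z $ i $ j) = mass z j / T"
      by (simp flip: sum_divide_distrib)
  qed
  then have "H P z = (\<chi> i j. mass z j / T)" unfolding H_def by (rule limI)
  then show ?thesis by (simp add: T_def)
qed

section \<open>\<open>H\<close> when somebody is stubborn\<close>

lemma reaches_stubborn:
  assumes z: "z \<in> cube" "z $ s = 1"
  shows "\<exists>s\<in>{s. z $ s = 1}. (i, s) \<in> (graph_of (W P z))\<^sup>*"
proof -
  have "(i, s) \<in> (graph_of P)\<^sup>*" using P_irred by (simp add: irreducible_mat_def)
  then show ?thesis
  proof (induction rule: converse_rtrancl_induct)
    case base then show ?case using z by auto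
  next
    case (step i j)
    \<comment> \<open>The walk in \<open>P\<close> is cut at the first stubborn agent it meets; the
      agents before have \<open>z $ i < 1\<close> and keep their edges in
      \<open>W P z\<close>.\<close>
    show ?case
    proof (cases "z $ i = 1")
      case True then show ?thesis by auto
    next
      case False
      then have "z $ i < 1" using z by (auto simp: cube_def less_le)
      from graph_of_W[OF z(1) this step(1)] step.IH show ?thesis
        by (meson converse_rtrancl_into_rtrancl)
    qed
  qed
qed

lemma H_stubborn:
  assumes z: "z \<in> cube" "z $ s = 1"
  shows "row_stochastic (H P z)" "W P z ** H P z = H P z"
    and "\<And>i j. z $ j \<noteq> 1 \<Longrightarrow> H P z $ i $ j = 0"
    and "\<And>i j. z $ i = 1 \<Longrightarrow> H P z $ i $ j = (if i = j then 1 else 0)"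
proof -
  note st = row_stochastic_W[OF P_stoch z(1)]
  obtain L where L: "mpow (W P z) \<longlonglongrightarrow> L" "\<And>i j. j \<notin> {s. z $ s = 1} \<Longrightarrow> L $ i $ j = 0"
    using mpow_tendsto_absorbing[OF st _ reaches_stubborn[OF z]] W_stubborn_row by blast
  have H: "H P z = L" unfolding H_def using L(1) by (rule limI)
  show "row_stochastic (H P z)" unfolding H by (rule mpow_limit_row_stochastic[OF st L(1)])
  show "W P z ** H P z = H P z" unfolding H by (rule mpow_limit_harmonic[OF L(1)])
  show "H P z $ i $ j = 0" if "z $ j \<noteq> 1" for i j unfolding H using L(2) that by simp
  show "H P z $ i $ j = (if i = j then 1 else 0)" if "z $ i = 1" for i j
  proof -
    have "(\<lambda>t. mpow (W P z) t $ i $ j) \<longlonglongrightarrow> L $ i $ j" by (intro tendsto_vec_nth L)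
    then show ?thesis
      unfolding H mpow_absorbing_row[of "W P z" i, OF W_stubborn_row[of z, OF that]] LIMSEQ_const_iff by simp
  qed
qed

text \<open>Both matrices have columns that are harmonic for \<^term>\<open>P\<close> off the stubborn set and share their
  boundary values there.\<close>

lemma H_cong_stubborn:
  assumes z: "z \<in> cube" "z' \<in> cube" "z $ s = 1" and same: "\<And>j. z $ j = 1 \<longleftrightarrow> z' $ j = 1"
  shows "H P z = H P z'"
proof -
  have z's: "z' $ s = 1" using z same by simp
  have harm: "(\<Sum>k\<in>UNIV. P $ i $ k * H P x $ k $ j) = H P x $ i $ j"
    if "x \<in> cube" "x $ s = 1" "x $ i \<noteq> 1" for x i j
  proof -
    have "(W P x ** H P x) $ i $ j = H P x $ i $ j" by (simp add: H_stubborn(2)[OF that(1,2)])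
    then have "(1 - x $ i) * (\<Sum>k\<in>UNIV. P $ i $ k * H P x $ k $ j) = (1 - x $ i) * H P x $ i $ j"
      unfolding matrix_mult_nth W_average by (simp add: algebra_simps)
    then show ?thesis using that(3) by simp
  qed
  \<comment> \<open>The difference of two columns is harmonic for \<open>W P x\<close> and vanishes
    on the stubborn set, so the maximum principle bounds it; exchanging the configurations then
    gives equality.\<close>
  have le: "H P x $ i $ j - H P x' $ i $ j \<le> 0"
    if x: "x \<in> cube" "x' \<in> cube" "x $ s = 1" "x' $ s = 1" "\<And>j. x $ j = 1 \<longleftrightarrow> x' $ j = 1" for x x' i j
  proof (rule harmonic_le_0[OF row_stochastic_W[OF P_stoch x(1)] _ reaches_stubborn[OF x(1,3)],
        of "\<lambda>i. H P x $ i $ j - H P x' $ i $ j"])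
    fix i
    show "(\<Sum>k\<in>UNIV. W P x $ i $ k * (H P x $ k $ j - H P x' $ k $ j)) = H P x $ i $ j - H P x' $ i $ j"
    proof (cases "x $ i = 1")
      case True then show ?thesis unfolding W_average by simp
    next
      case False
      then have "(\<Sum>k\<in>UNIV. P $ i $ k * (H P x $ k $ j - H P x' $ k $ j)) = H P x $ i $ j - H P x' $ i $ j"
        using x by (simp add: right_diff_distrib sum_subtractf harm)
      then show ?thesis unfolding W_average by (simp only: flip: distrib_right) simp
    qed
  next
    fix k assume "k \<in> {s. x $ s = 1}"
    then show "H P x $ k $ j - H P x' $ k $ j \<le> 0"
      using H_stubborn(4)[OF x(1,3), of k] H_stubborn(4)[OF x(2,4), of k] x(5) by simp
  qed
  have "H P z $ i $ j = H P z' $ i $ j" for i j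
    using le[of z z' i j] le[of z' z i j] z z's same by auto
  then show ?thesis by (simp add: vec_eq_iff)
qed

section \<open>Costs and best responses\<close>

lemma cost_stubborn_self:
  assumes "z \<in> cube" "z $ i = 1"
  shows "cost P sigma2 i z = sigma2 $ i"
proof -
  have "cost P sigma2 i z = (\<Sum>j\<in>UNIV. if i = j then sigma2 $ j else 0)"
    unfolding cost_def H_stubborn(4)[OF assms assms(2)] by (intro sum.cong) auto
  then show ?thesis by simp
qed

text \<open>Row \<open>i\<close> of \<open>H P z\<close> is a probability vector \<open>h\<close> on
  the stubborn set, and \<open>h j \<le> 1\<close> bounds each squared term by
  \<open>h j * sigma2 $ i\<close>.\<close>

lemma cost_le_if_noisier_than_stubborn:
  assumes z: "z \<in> cube" "z $ s = 1" and le: "\<And>j. z $ j = 1 \<Longrightarrow> sigma2 $ j \<le> sigma2 $ i"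
  shows "cost P sigma2 i z \<le> sigma2 $ i"
proof -
  note st = H_stubborn(1)[OF z]
  have "(H P z $ i $ j)\<^sup>2 * sigma2 $ j \<le> H P z $ i $ j * sigma2 $ i" for j
  proof (cases "z $ j = 1")
    case True
    have h: "0 \<le> H P z $ i $ j" "H P z $ i $ j \<le> 1"
      using st row_stochastic_le_1[OF st] by (auto simp: row_stochastic_def)
    then have "(H P z $ i $ j)\<^sup>2 \<le> H P z $ i $ j" by (simp add: power2_eq_square mult_left_le)
    then show ?thesis using le[OF True] h sigma_pos[of j] by (intro mult_mono) (auto simp: less_imp_le)
  next
    case False then show ?thesis by (simp add: H_stubborn(3)[OF z])
  qed
  then have "cost P sigma2 i z \<le> (\<Sum>j\<in>UNIV. H P z $ i $ j * sigma2 $ i)"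
    unfolding cost_def by (rule sum_mono)
  also have "\<dots> = sigma2 $ i" using st by (simp add: row_stochastic_def flip: sum_distrib_right)
  finally show ?thesis .
qed

lemma cost_nonstubborn:
  assumes "z \<in> cube" "\<And>i. z $ i < 1"
  shows "cost P sigma2 i z = (\<Sum>j\<in>UNIV. (mass z j)\<^sup>2 * sigma2 $ j) / (\<Sum>j\<in>UNIV. mass z j)\<^sup>2"
  by (simp add: cost_def H_nonstubborn[OF assms] power_divide sum_divide_distrib)

lemma best_resp_subset: "best_resp P sigma2 k z \<subseteq> {0..1}"
  by (auto simp: best_resp_def)

text \<open>As a function of her own \<open>x\<close>, the cost of \<open>k\<close> takes only two
  values: a constant \<open>c\<close> for \<open>x < 1\<close>, where the stubborn set stays the
  same, and \<open>sigma2 $ k\<close> at 1. Comparing the two decides the best response.\<close>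

lemma best_resp_other_stubborn:
  assumes z: "z \<in> cube" and s: "z $ s = 1" "s \<noteq> k"
  shows "best_resp P sigma2 k z \<noteq> {}"
    and "(\<And>j. j \<noteq> k \<Longrightarrow> z $ j = 1 \<Longrightarrow> sigma2 $ j \<le> sigma2 $ k) \<Longrightarrow> 0 \<in> best_resp P sigma2 k z"
proof -
  define c where "c = cost P sigma2 k (upd z k 0)"
  have eq: "cost P sigma2 k (upd z k x) = (if x = 1 then sigma2 $ k else c)"
    if "x \<in> {0..1}" for x
  proof (cases "x = 1")
    case True
    then show ?thesis using z by (simp add: cost_stubborn_self upd_in_cube)
  next
    case False
    then have "H P (upd z k x) = H P (upd z k 0)"
      using that s z by (intro H_cong_stubborn[of _ _ s]) (auto simp: upd_in_cube)
    with False show ?thesis by (simp add: cost_def c_def)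
  qed
  show "best_resp P sigma2 k z \<noteq> {}"
  proof (cases "sigma2 $ k \<le> c")
    case True
    then have "1 \<in> best_resp P sigma2 k z" by (auto simp: best_resp_def eq)
    then show ?thesis by blast
  next
    case False
    then have "0 \<in> best_resp P sigma2 k z" by (auto simp: best_resp_def eq)
    then show ?thesis by blast
  qed
  assume le: "\<And>j. j \<noteq> k \<Longrightarrow> z $ j = 1 \<Longrightarrow> sigma2 $ j \<le> sigma2 $ k"
  have "c \<le> sigma2 $ k"
    unfolding c_def by (rule cost_le_if_noisier_than_stubborn[of _ s]) (use z s le in \<open>auto simp: upd_in_cube split: if_splits\<close>)
  then show "0 \<in> best_resp P sigma2 k z" by (auto simp: best_resp_def eq)
qed

lemma best_resp_single_agent:
  assumes z: "z \<in> cube" and U: "UNIV = {k}"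
  shows "0 \<in> best_resp P sigma2 k z"
proof -
  have "cost P sigma2 k (upd z k x) = sigma2 $ k" if "x \<in> {0..1}" for x
  proof (cases "x = 1")
    case True then show ?thesis using z by (simp add: cost_stubborn_self upd_in_cube)
  next
    case False
    have "upd z k x $ i < 1" for i using False that U by auto
    moreover from this have "mass (upd z k x) k > 0" by (rule mass_pos)
    ultimately show ?thesis using z that by (subst cost_nonstubborn) (auto simp: upd_in_cube U)
  qed
  then show ?thesis by (auto simp: best_resp_def)
qed

text \<open>Each numerator term is mass times \<open>mass z j * sigma2 $ j\<close>, so this is the
  mass-weighted mean of the other levels. Divided by \<open>sigma2 $ k\<close> it is the
  unconstrained optimum for the mass of \<open>k\<close>.\<close>

definition others_avg :: "real ^ 'n \<Rightarrow> 'n \<Rightarrow> real" where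
  "others_avg z k = (\<Sum>j\<in>UNIV - {k}. (mass z j)\<^sup>2 * sigma2 $ j) / (\<Sum>j\<in>UNIV - {k}. mass z j)"

text \<open>The substitution \<open>b = p / (1 - x)\<close> maps \<open>0 \<le> x < 1\<close> onto
  \<open>b \<ge> p\<close> and turns the cost into \<open>F (g b)\<close>, where \<open>F\<close>
  increases with the absolute value of its argument. The increasing function \<open>g\<close>
  vanishes at \<open>c\<close>, so the constrained minimiser is \<open>max p c\<close>.\<close>

lemma best_resp_others_nonstubborn:
  assumes z: "z \<in> cube" and lt: "\<And>j. j \<noteq> k \<Longrightarrow> z $ j < 1" and l: "l \<noteq> k"
  defines "a \<equiv> max (pv $ k) (others_avg z k / sigma2 $ k)"
  shows "best_resp P sigma2 k z = {1 - pv $ k / a}"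
proof -
  define S Q s where "S = (\<Sum>j\<in>UNIV - {k}. mass z j)"
    and "Q = (\<Sum>j\<in>UNIV - {k}. (mass z j)\<^sup>2 * sigma2 $ j)" and "s = sigma2 $ k"
  have mp: "mass z j > 0" if "j \<noteq> k" for j using mass_pos lt that by blast
  have "S > 0" unfolding S_def by (intro sum_pos) (use l mp in auto)
  moreover have "Q > 0" unfolding Q_def
    by (intro sum_pos) (use l mp sigma_pos in \<open>auto intro!: mult_pos_pos zero_less_power\<close>)
  moreover have "s > 0" by (simp add: s_def sigma_pos)
  moreover define c where "c = Q / (S * s)"
  ultimately have pos: "S > 0" "Q > 0" "s > 0" "c > 0" by simp_all
  define p where "p = pv $ k"
  have "p > 0" by (simp add: p_def pv_pos)
  have a: "a = max p c" by (simp add: a_def p_def c_def others_avg_def Q_def S_def s_def)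
  define g where "g b = (b - c) / (S + b)" for b
  define F where "F w = s / (S + c) * (c + S * w\<^sup>2)" for w
  have cost_lt: "cost P sigma2 k (upd z k x) = F (g (p / (1 - x)))" if x: "0 \<le> x" "x < 1" for x
  proof -
    let ?z = "upd z k x" and ?b = "p / (1 - x)"
    have m: "mass ?z j = (if j = k then ?b else mass z j)" for j by (simp add: mass_def p_def)
    have "cost P sigma2 k ?z
        = (\<Sum>j\<in>UNIV. (mass ?z j)\<^sup>2 * sigma2 $ j) / (\<Sum>j\<in>UNIV. mass ?z j)\<^sup>2"
      using x lt z by (intro cost_nonstubborn) (auto simp: upd_in_cube)
    also have "(\<Sum>j\<in>UNIV. (mass ?z j)\<^sup>2 * sigma2 $ j) = ?b\<^sup>2 * s + Q"
      by (subst sum.remove[of _ k]) (auto simp: m Q_def s_def)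
    also have "(\<Sum>j\<in>UNIV. mass ?z j) = ?b + S"
      by (subst sum.remove[of _ k]) (auto simp: m S_def)
    finally have "cost P sigma2 k ?z = (Q + ?b\<^sup>2 * s) / (S + ?b)\<^sup>2" by (simp add: add.commute)
    also have "\<dots> = F (g ?b)"
      unfolding F_def g_def using pos \<open>p > 0\<close> x by (intro average_cost_identity) (auto simp: c_def)
    finally show ?thesis .
  qed
  \<comment> \<open>Stubbornness corresponds to \<open>b\<close> tending to infinity, where
    \<open>g b\<close> tends to 1; the bound \<open>\<bar>g a\<bar> < 1\<close> below therefore
    excludes \<open>x = 1\<close>.\<close>
  have cost_1: "cost P sigma2 k (upd z k 1) = F 1"
  proof -
    have "F 1 = s" using pos by (simp add: F_def field_simps)
    then show ?thesis using z by (simp add: cost_stubborn_self upd_in_cube s_def)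
  qed
  have g_mono: "g b < g b'" if "0 < b" "b < b'" for b b'
  proof -
    have "(b - c) * (S + b') < (b' - c) * (S + b)"
    proof -
      have "(b' - c) * (S + b) - (b - c) * (S + b') = (S + c) * (b' - b)" by algebra
      also have "\<dots> > 0" using pos that by simp
      finally show ?thesis by simp
    qed
    then show ?thesis unfolding g_def using pos that by (simp add: divide_simps)
  qed
  have "a > 0" "a \<ge> p" using \<open>p > 0\<close> by (auto simp: a)
  define x0 where "x0 = 1 - p / a"
  have x0: "0 \<le> x0" "x0 < 1" "p / (1 - x0) = a"
    using \<open>a > 0\<close> \<open>a \<ge> p\<close> \<open>p > 0\<close> by (auto simp: x0_def)
  have F_mono: "F w < F w'" if "\<bar>w\<bar> < \<bar>w'\<bar>" for w w'
  proof -
    have "w\<^sup>2 < w'\<^sup>2" using power_strict_mono[OF that, of 2] by simp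
    then show ?thesis unfolding F_def using pos by (intro mult_strict_left_mono) auto
  qed
  have "\<bar>g a\<bar> < \<bar>g b\<bar>" if "b \<ge> p" "b \<noteq> a" for b
  proof (cases "c \<ge> p")
    case True
    then have "g a = 0" by (simp add: a g_def)
    moreover have "g b \<noteq> 0" using True that pos \<open>p > 0\<close> by (auto simp: a g_def)
    ultimately show ?thesis by simp
  next
    case False
    then have "a = p" "g a \<ge> 0" using pos by (auto simp: a g_def)
    moreover have "g a < g b" using that \<open>a = p\<close> \<open>a > 0\<close> by (intro g_mono) auto
    ultimately show ?thesis by simp
  qed
  moreover have "\<bar>g a\<bar> < 1" using pos \<open>a > 0\<close> by (auto simp: g_def a abs_if field_simps)
  ultimately have strict: "F (g a) < cost P sigma2 k (upd z k x)" if "x \<in> {0..1}" "x \<noteq> x0" for x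
  proof (cases "x = 1")
    case True
    then show ?thesis using \<open>\<bar>g a\<bar> < 1\<close> by (simp add: cost_1 F_mono)
  next
    case False
    then have x: "0 \<le> x" "x < 1" using that by auto
    have "p / (1 - x) \<ge> p" using x \<open>p > 0\<close> by (simp add: field_simps)
    moreover have "p / (1 - x) \<noteq> a"
      using x that(2) \<open>p > 0\<close> \<open>a > 0\<close> by (auto simp: x0_def field_simps)
    ultimately show ?thesis
      using \<open>\<And>b. \<lbrakk>p \<le> b; b \<noteq> a\<rbrakk> \<Longrightarrow> \<bar>g a\<bar> < \<bar>g b\<bar>\<close> x by (simp add: cost_lt F_mono)
  qed
  have c0: "cost P sigma2 k (upd z k x0) = F (g a)" using x0 by (simp add: cost_lt)
  have "best_resp P sigma2 k z = {x0}"
  proof (intro set_eqI iffI)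
    fix x assume "x \<in> best_resp P sigma2 k z"
    then have "x \<in> {0..1}" "cost P sigma2 k (upd z k x) \<le> F (g a)"
      using x0 c0 by (auto simp: best_resp_def dest!: bspec[of _ _ x0])
    then show "x \<in> {x0}" using strict[of x] by fastforce
  next
    fix x assume "x \<in> {x0}"
    moreover have "F (g a) \<le> cost P sigma2 k (upd z k y)" if "y \<in> {0..1}" for y
      using strict[of y] c0 that by (cases "y = x0") auto
    ultimately show "x \<in> best_resp P sigma2 k z" using x0 c0 by (auto simp: best_resp_def)
  qed
  then show ?thesis by (simp add: x0_def p_def)
qed

end

section \<open>Convergence of the dynamics\<close>

text \<open>A coordinate-wise averaging dynamics with floors \<open>m\<close>. The first agent of the word either already sees a
  large value among the others, or has a large floor, or else lowers the maximum; in the first two cases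
  all later agents of the word are pulled up by it.\<close>

lemma word_contracts_osc:
  fixes \<beta> :: "nat \<Rightarrow> 'n::finite \<Rightarrow> real"
  assumes keep: "\<And>t j. j \<noteq> \<kappa> t \<Longrightarrow> \<beta> (Suc t) j = \<beta> t j"
    and new: "\<And>t. \<beta> (Suc t) (\<kappa> t) = max (m (\<kappa> t)) (A t)"
    and floor: "\<And>t j. m j \<le> \<beta> t j"
    and up: "\<And>t c. (\<And>j. j \<noteq> \<kappa> t \<Longrightarrow> \<beta> t j \<le> c) \<Longrightarrow> A t \<le> c"
    and down: "\<And>t lo c l. (\<And>j. j \<noteq> \<kappa> t \<Longrightarrow> lo \<le> \<beta> t j) \<Longrightarrow> l \<noteq> \<kappa> t \<Longrightarrow> lo \<le> c \<Longrightarrow> c \<le> \<beta> t l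
        \<Longrightarrow> lo + \<delta> * (c - lo) \<le> A t"
    and \<delta>: "0 < \<delta>" "\<delta> \<le> 1" and two: "\<And>k::'n. \<exists>l. l \<noteq> k"
  shows "osc (\<beta> (Suc t)) \<le> osc (\<beta> t)"
    and "(\<And>r. r < length ws \<Longrightarrow> \<kappa> (t + r) = ws ! r) \<Longrightarrow> distinct ws \<Longrightarrow> set ws = UNIV
      \<Longrightarrow> osc (\<beta> (t + length ws)) \<le> (1 - \<delta>\<^sup>2 / 2) * osc (\<beta> t)"
proof -
  \<comment> \<open>The floor cannot lift the maximum, since it never exceeds the current value of
    the same agent.\<close>
  have hi_step: "\<beta> (Suc t) j \<le> hi" if "\<And>j. \<beta> t j \<le> hi" for t j hi
    using that up[of t hi] floor[of "\<kappa> t" t] new[of t] keep[of j t] order_trans[OF floor that]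
    by (cases "j = \<kappa> t") auto
  have lo_step: "lo \<le> \<beta> (Suc t) j" if "\<And>j. lo \<le> \<beta> t j" for t j lo
  proof (cases "j = \<kappa> t")
    case True
    obtain l where "l \<noteq> \<kappa> t" using two by blast
    \<comment> \<open>With \<open>c = lo\<close> the gain term vanishes and \<open>down\<close>
      becomes a plain lower bound on the average.\<close>
    then have "lo \<le> A t" using down[of t lo l lo] that by simp
    then show ?thesis using True new[of t] by simp
  qed (use keep that in simp)
  have hi: "\<beta> (t + r) j \<le> hi" if "\<And>j. \<beta> t j \<le> hi" for t r j hi
    using that by (induction r arbitrary: j) (auto intro: hi_step)
  have lo: "lo \<le> \<beta> (t + r) j" if "\<And>j. lo \<le> \<beta> t j" for t r j lo
    using that by (induction r arbitrary: j) (auto intro: lo_step)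
  have osc_mono: "osc (\<beta> (t + r)) \<le> osc (\<beta> t)" for t r
    unfolding osc_def[of "\<beta> t"] by (rule osc_le; (rule hi lo)?) auto
  show "osc (\<beta> (Suc t)) \<le> osc (\<beta> t)" using osc_mono[of t 1] by simp
  assume word: "\<And>r. r < length ws \<Longrightarrow> \<kappa> (t + r) = ws ! r" and dist: "distinct ws" and ws: "set ws = UNIV"
  let ?n = "length ws"
  have n: "?n > 0" using ws by auto
  define l u D where "l = Min (range (\<beta> t))" and "u = Max (range (\<beta> t))" and "D = osc (\<beta> t)"
  have lu: "l \<le> \<beta> t j" "\<beta> t j \<le> u" for j by (auto simp: l_def u_def)
  have D: "D = u - l" "0 \<le> D" by (auto simp: D_def osc_def l_def u_def osc_nonneg[unfolded osc_def])
  define k where "k = ws ! 0"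
  have k: "\<kappa> t = k" using word[of 0] n by (simp add: k_def)
  have "\<delta>\<^sup>2 \<le> \<delta>" using \<delta> by (simp add: power2_eq_square mult_left_le)
  show "osc (\<beta> (t + ?n)) \<le> (1 - \<delta>\<^sup>2 / 2) * osc (\<beta> t)"
  proof (cases "l + \<delta> * (D / 2) \<le> \<beta> (Suc t) k")
    case True
    \<comment> \<open>\<open>k\<close> occurs only once in the word, so it keeps its height after
      the first step; each later agent receives at least the fraction \<open>\<delta>\<close> of it,
      whence \<open>\<delta>\<^sup>2\<close>.\<close>
    have raised: "(\<forall>s<r. l + \<delta>\<^sup>2 * (D / 2) \<le> \<beta> (t + r) (ws ! s)) \<and> l + \<delta> * (D / 2) \<le> \<beta> (t + r) k"
      if "1 \<le> r" "r \<le> ?n" for r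
      using that
    proof (induction r rule: dec_induct)
      case base
      have "\<delta>\<^sup>2 * (D / 2) \<le> \<delta> * (D / 2)" using \<open>\<delta>\<^sup>2 \<le> \<delta>\<close> D by (intro mult_right_mono) auto
      then show ?case using True by (auto simp: k_def)
    next
      case (step r)
      have IH: "\<forall>s<r. l + \<delta>\<^sup>2 * (D / 2) \<le> \<beta> (t + r) (ws ! s)" "l + \<delta> * (D / 2) \<le> \<beta> (t + r) k"
        using step by auto
      have kr: "\<kappa> (t + r) = ws ! r" using word step by simp
      have r: "0 < r" "r < ?n" using step by auto
      have ne: "ws ! r \<noteq> k" using dist r n by (simp add: k_def nth_eq_iff_index_eq)
      have "l + \<delta> * ((l + \<delta> * (D / 2)) - l) \<le> A (t + r)"
        by (rule down[where l = k]) (use lo[of l t] lu IH kr ne \<delta> D in auto)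
      then have "l + \<delta>\<^sup>2 * (D / 2) \<le> \<beta> (Suc (t + r)) (ws ! r)"
        using new[of "t + r"] kr by (simp add: power2_eq_square)
      moreover have "\<beta> (Suc (t + r)) j = \<beta> (t + r) j" if "j \<noteq> ws ! r" for j
        using keep kr that by simp
      moreover have "ws ! s \<noteq> ws ! r" if "s < r" for s
        using dist r that by (simp add: nth_eq_iff_index_eq)
      ultimately show ?case using IH ne by (auto simp: less_Suc_eq)
    qed
    have "l + \<delta>\<^sup>2 * (D / 2) \<le> \<beta> (t + ?n) j" for j
    proof -
      obtain s where "s < ?n" "ws ! s = j" using ws by (metis UNIV_I in_set_conv_nth)
      then show ?thesis using raised[of ?n] n by auto
    qed
    then have "osc (\<beta> (t + ?n)) \<le> u - (l + \<delta>\<^sup>2 * (D / 2))"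
      by (intro osc_le hi lu)
    also have "\<dots> = (1 - \<delta>\<^sup>2 / 2) * D" unfolding D(1) by (simp add: field_simps)
    finally show ?thesis by (simp add: D_def)
  next
    \<comment> \<open>The new value of \<open>k\<close> is low, which bounds both terms of the
      maximum: neither another agent nor the floor can exceed the midpoint \<open>l + D / 2\<close>,
      and a single step already halves the oscillation.\<close>
    case False
    have "\<beta> t j \<le> l + D / 2" if "j \<noteq> k" for j
    proof (rule ccontr)
      assume "\<not> \<beta> t j \<le> l + D / 2"
      then have "l + \<delta> * (l + D / 2 - l) \<le> A t"
        by (intro down[where l = j]) (use lu that k D in auto)
      then show False using new[of t] k False by simp
    qed
    moreover have "m k \<le> l + D / 2"
    proof -
      have "\<delta> * (D / 2) \<le> D / 2" using \<delta> D by (simp add: mult_left_le_one_le)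
      then show ?thesis using False new[of t] k by simp
    qed
    ultimately have "\<beta> (Suc t) j \<le> l + D / 2" for j
      using up[of t "l + D / 2"] new[of t] k keep[of j t] by (cases "j = k") auto
    then have "osc (\<beta> (Suc t)) \<le> l + D / 2 - l"
      by (intro osc_le lo_step lu)
    moreover have "osc (\<beta> (t + ?n)) \<le> osc (\<beta> (Suc t))"
      using osc_mono[of "Suc t" "?n - 1"] n by simp
    \<comment> \<open>Since \<open>\<delta>\<^sup>2 \<le> 1\<close>, halving is at least as strong
      as the claimed factor.\<close>
    moreover have "\<delta>\<^sup>2 * D \<le> D" using \<open>\<delta>\<^sup>2 \<le> \<delta>\<close> \<delta> D by (simp add: mult_left_le_one_le)
    ultimately show ?thesis unfolding D_def[symmetric] by (simp add: algebra_simps)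
  qed
qed

section \<open>Levels and their weighted averages\<close>

context opinion_game
begin

definition level :: "real ^ 'n \<Rightarrow> 'n \<Rightarrow> real" where
  "level z j = mass z j * sigma2 $ j"

lemma level_ge: "z \<in> cube \<Longrightarrow> z $ j < 1 \<Longrightarrow> pv $ j * sigma2 $ j \<le> level z j"
  using pv_pos[of j] sigma_pos[of j]
  by (auto simp: level_def mass_def cube_def divide_simps intro!: mult_right_mono mult_left_le)

lemma level_pos: "z $ j < 1 \<Longrightarrow> 0 < level z j"
  by (simp add: level_def mass_pos sigma_pos)

lemma others_avg_eq:
  "others_avg z k = (\<Sum>j\<in>UNIV - {k}. mass z j * level z j) / (\<Sum>j\<in>UNIV - {k}. mass z j)"
  by (simp add: others_avg_def level_def power2_eq_square mult.assoc)

lemma others_mass_pos: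
  assumes "\<And>j. z $ j < 1" "l \<noteq> k"
  shows "0 < (\<Sum>j\<in>UNIV - {k}. mass z j)"
  using assms by (intro sum_pos) (auto simp: mass_pos)

lemma others_avg_le:
  assumes lt: "\<And>j. z $ j < 1" and "l \<noteq> k" and le: "\<And>j. j \<noteq> k \<Longrightarrow> level z j \<le> c"
  shows "others_avg z k \<le> c"
proof -
  have "(\<Sum>j\<in>UNIV - {k}. mass z j * level z j) \<le> (\<Sum>j\<in>UNIV - {k}. mass z j * c)"
    using le mass_pos[OF lt] by (intro sum_mono mult_left_mono) (auto simp: less_imp_le)
  also have "\<dots> = c * (\<Sum>j\<in>UNIV - {k}. mass z j)" by (simp add: mult.commute sum_distrib_left)
  finally show ?thesis
    using others_mass_pos[OF lt \<open>l \<noteq> k\<close>] by (simp add: others_avg_eq divide_simps)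
qed

text \<open>A lower bound for the share of one agent in the mass of the others while all levels are
  at most \<open>C\<close>: her mass is at least \<open>pv $ l\<close>, and every mass is at most
  \<open>C / sigma2 $ j\<close>. The minimum with 1 makes it admissible as the
  \<open>\<delta>\<close> of \<open>word_contracts_osc\<close>.\<close>

definition weight_bound :: "real \<Rightarrow> real" where
  "weight_bound C = min 1 (Min (range (($) pv)) / (C * (\<Sum>j\<in>UNIV. 1 / sigma2 $ j)))"

lemma weight_bound: "0 < C \<Longrightarrow> 0 < weight_bound C" "weight_bound C \<le> 1"
  by (auto simp: weight_bound_def pv_pos sigma_pos intro!: divide_pos_pos mult_pos_pos sum_pos)

text \<open>Agent \<open>l\<close> alone contributes at least the share
  \<open>weight_bound C\<close> of her excess over \<open>lo\<close>, and the other excesses are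
  nonnegative. This supplies the premise \<open>down\<close> of
  \<open>word_contracts_osc\<close>.\<close>

lemma others_avg_ge:
  assumes z: "z \<in> cube" and lt: "\<And>j. z $ j < 1" and C: "\<And>j. level z j \<le> C" and l: "l \<noteq> k"
    and lo: "\<And>j. j \<noteq> k \<Longrightarrow> lo \<le> level z j" and c: "lo \<le> c" "c \<le> level z l"
  shows "lo + weight_bound C * (c - lo) \<le> others_avg z k"
proof -
  define S where "S = (\<Sum>j\<in>UNIV - {k}. mass z j)"
  have S: "S > 0" unfolding S_def by (rule others_mass_pos[OF lt l])
  have mp: "mass z j > 0" for j by (rule mass_pos[OF lt])
  have "C > 0" using C[of l] level_pos[OF lt, of l] by simp
  have T: "(\<Sum>j\<in>UNIV. 1 / sigma2 $ j) > 0" by (intro sum_pos) (auto simp: sigma_pos)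
  have "S \<le> (\<Sum>j\<in>UNIV. mass z j)"
    unfolding S_def by (intro sum_mono2) (use mp in \<open>auto simp: less_imp_le\<close>)
  also have "\<dots> \<le> (\<Sum>j\<in>UNIV. C * (1 / sigma2 $ j))"
    using C sigma_pos by (intro sum_mono) (simp add: level_def field_simps)
  finally have S_le: "S \<le> C * (\<Sum>j\<in>UNIV. 1 / sigma2 $ j)" by (simp add: sum_distrib_left)
  have "Min (range (($) pv)) \<le> pv $ l" by simp
  also have "\<dots> \<le> mass z l" using level_ge[OF z lt, of l] sigma_pos[of l] by (simp add: level_def)
  finally have "Min (range (($) pv)) / (C * (\<Sum>j\<in>UNIV. 1 / sigma2 $ j)) \<le> mass z l / S"
    using S S_le mp[of l] by (intro frac_le) auto
  then have "weight_bound C \<le> mass z l / S" by (simp add: weight_bound_def)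
  then have "weight_bound C * (c - lo) \<le> mass z l / S * (c - lo)" using c by (intro mult_right_mono) auto
  also have "\<dots> \<le> mass z l / S * (level z l - lo)"
    using c S mp[of l] by (intro mult_left_mono) (auto simp: less_imp_le)
  also have "\<dots> = (mass z l * (level z l - lo)) / S" by simp
  also have "\<dots> \<le> (\<Sum>j\<in>UNIV - {k}. mass z j * (level z j - lo)) / S"
    using l lo S mp by (intro divide_right_mono member_le_sum[of l _ "\<lambda>j. mass z j * (level z j - lo)"])
      (auto simp: less_imp_le)
  also have "(\<Sum>j\<in>UNIV - {k}. mass z j * (level z j - lo)) = (\<Sum>j\<in>UNIV - {k}. mass z j * level z j) - S * lo"
    by (simp add: right_diff_distrib sum_subtractf S_def sum_distrib_right)
  also have "\<dots> / S = others_avg z k - lo"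
    using S by (simp add: others_avg_eq S_def diff_divide_distrib)
  finally show ?thesis by simp
qed

section \<open>A single step of the dynamics\<close>

lemma best_resp_cases:
  obtains s where "s \<noteq> k" "z $ s = 1" | "UNIV = {k}" | l where "l \<noteq> k" "\<And>j. j \<noteq> k \<Longrightarrow> z $ j \<noteq> (1::real)"
  by blast

lemma best_resp_nonempty:
  assumes z: "z \<in> cube"
  shows "best_resp P sigma2 k z \<noteq> {}"
proof (cases rule: best_resp_cases[of k z])
  case (1 s)
  then show ?thesis using best_resp_other_stubborn(1)[OF z] by blast
next
  case 2
  then show ?thesis using best_resp_single_agent[OF z] by blast
next
  case (3 l)
  then have "j \<noteq> k \<Longrightarrow> z $ j < 1" for j using z by (auto simp: cube_def less_le)
  then show ?thesis using best_resp_others_nonstubborn[OF z _ 3(1)] by simp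
qed

lemma br_step_in_cube:
  assumes z: "z \<in> cube" and u: "0 \<le> u" "u < 1"
  shows "br_step P sigma2 z k u \<in> cube"
proof -
  let ?B = "best_resp P sigma2 k z"
  obtain x where x: "x \<in> ?B" using best_resp_nonempty[OF z] by blast
  have sub: "b \<in> {0..1}" if "b \<in> ?B" for b using best_resp_subset that by blast
  have bdd: "bdd_above ?B" "bdd_below ?B" using sub by (auto intro!: bdd_aboveI[of _ 1] bdd_belowI[of _ 0])
  have "0 \<le> Inf ?B" using sub x by (intro cInf_greatest) auto
  moreover have "Sup ?B \<le> 1" using sub x by (intro cSup_least) auto
  moreover have "Inf ?B \<le> x" "x \<le> Sup ?B" using x bdd by (auto intro: cInf_lower cSup_upper)
  moreover have "u * (Sup ?B - Inf ?B) \<le> Sup ?B - Inf ?B"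
    using calculation u by (intro mult_left_le_one_le) auto
  moreover have "0 \<le> u * (Sup ?B - Inf ?B)" using calculation u by simp
  ultimately show ?thesis using z by (auto simp: br_step_def Let_def intro!: upd_in_cube)
qed

text \<open>If somebody else is stubborn, or \<open>k\<close> is alone, then 0 is a best response
  and the draw is at most \<open>u\<close>, hence below 1. Otherwise the only best response is
  explicit and below 1.\<close>

lemma br_step_lt_1:
  assumes z: "z \<in> cube" and u: "0 \<le> u" "u < 1"
    and max: "\<And>j. j \<noteq> k \<Longrightarrow> z $ j = 1 \<Longrightarrow> sigma2 $ j \<le> sigma2 $ k"
  shows "br_step P sigma2 z k u $ k < 1"
proof -
  let ?B = "best_resp P sigma2 k z"
  have *: ?thesis if "0 \<in> ?B"
  proof -
    have sub: "b \<in> {0..1}" if "b \<in> ?B" for b using best_resp_subset that by blast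
    have "Inf ?B = 0" using that sub by (intro cInf_eq_minimum) auto
    moreover have "Sup ?B \<le> 1" using that sub by (intro cSup_least) auto
    then have "u * Sup ?B \<le> u" using u by (simp add: mult_left_le)
    ultimately show ?thesis using u by (simp add: br_step_def Let_def)
  qed
  show ?thesis
  proof (cases rule: best_resp_cases[of k z])
    case (1 s)
    then show ?thesis using best_resp_other_stubborn(2)[OF z _ _ max] * by blast
  next
    case 2
    then show ?thesis using best_resp_single_agent[OF z] * by blast
  next
    case (3 l)
    then have "j \<noteq> k \<Longrightarrow> z $ j < 1" for j using z by (auto simp: cube_def less_le)
    then have "?B = {1 - pv $ k / max (pv $ k) (others_avg z k / sigma2 $ k)}"
      by (rule best_resp_others_nonstubborn[OF z _ 3(1)])
    then show ?thesis using pv_pos[of k] by (simp add: br_step_def Let_def less_max_iff_disj)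
  qed
qed

lemma br_step_other: "j \<noteq> k \<Longrightarrow> br_step P sigma2 z k u $ j = z $ j"
  by (simp add: br_step_def Let_def)

lemma level_br_step:
  assumes z: "z \<in> cube" and lt: "\<And>j. z $ j < 1" and l: "l \<noteq> k"
  shows "level (br_step P sigma2 z k u) k = max (pv $ k * sigma2 $ k) (others_avg z k)"
proof -
  define a where "a = max (pv $ k) (others_avg z k / sigma2 $ k)"
  have "best_resp P sigma2 k z = {1 - pv $ k / a}"
    unfolding a_def using lt by (intro best_resp_others_nonstubborn[OF z _ l])
  then have "level (br_step P sigma2 z k u) k = a * sigma2 $ k"
    using pv_pos[of k] by (simp add: level_def mass_def br_step_def Let_def)
  also have "\<dots> = max (pv $ k * sigma2 $ k) (others_avg z k)"
    using sigma_pos[of k] by (simp add: a_def max_def field_simps)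
  finally show ?thesis .
qed

lemma infdist_Zstar_le:
  assumes z: "z \<in> cube" and lt: "\<And>j. z $ j < 1"
  shows "infdist z (Zstar pv sigma2) \<le> real CARD('n) * alpha_star pv sigma2 * osc (level z)"
proof -
  define mm where "mm = Max (range (\<lambda>i. pv $ i * sigma2 $ i))"
  have mm: "pv $ i * sigma2 $ i \<le> mm" for i by (auto simp: mm_def)
  have mpos: "0 < pv $ i * sigma2 $ i" for i by (simp add: pv_pos sigma_pos)
  have "mm > 0" using mpos[of undefined] mm[of undefined] by simp
  define hi where "hi = Max (range (level z))"
  have hi: "level z i \<le> hi" for i by (auto simp: hi_def)
  have "mm \<le> hi"
    unfolding mm_def by (auto intro!: Max.boundedI order_trans[OF level_ge[OF z lt] hi])
  \<comment> \<open>The point whose levels all equal \<open>hi\<close>, that is,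
    \<open>\<alpha> = 1 / hi\<close>; it is admissible because \<open>mm \<le> hi\<close>.\<close>
  define p :: "real ^ 'n" where "p = (\<chi> i. 1 - 1 / hi * pv $ i * sigma2 $ i)"
  have "p \<in> Zstar pv sigma2"
    unfolding Zstar_def p_def alpha_star_def mm_def[symmetric]
    using \<open>mm > 0\<close> \<open>mm \<le> hi\<close> by (intro CollectI exI[of _ "1 / hi"]) (simp add: frac_le)
  then have "infdist z (Zstar pv sigma2) \<le> dist z p" by (rule infdist_le)
  also have "\<dots> \<le> (\<Sum>i\<in>UNIV. \<bar>(z - p) $ i\<bar>)" unfolding dist_norm by (rule norm_le_l1_cart)
  also have "\<dots> \<le> (\<Sum>i\<in>(UNIV :: 'n set). alpha_star pv sigma2 * osc (level z))"
  proof (rule sum_mono)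
    fix i
    let ?m = "pv $ i * sigma2 $ i" and ?b = "level z i"
    have b: "?b > 0" "?m \<le> ?b" "hi > 0" using level_pos[OF lt] level_ge[OF z lt] \<open>mm > 0\<close> \<open>mm \<le> hi\<close> by auto
    have "z $ i = 1 - ?m / ?b" using lt[of i] pv_pos[of i] sigma_pos[of i] by (simp add: level_def mass_def)
    then have "(z - p) $ i = ?m / hi - ?m / ?b" by (simp add: p_def)
    also have "\<dots> = - (?m / ?b * ((hi - ?b) / hi))" using b by (simp add: field_simps)
    finally have "\<bar>(z - p) $ i\<bar> = ?m / ?b * ((hi - ?b) / hi)"
      using b hi[of i] mpos[of i] 
      by (simp add: abs_mult abs_of_pos[OF pv_pos] abs_of_pos[OF sigma_pos])
    \<comment> \<open>\<open>?m \<le> ?b\<close> bounds the first factor, and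
      \<open>mm \<le> hi\<close> makes the denominator independent of \<open>z\<close>.\<close>
    also have "\<dots> \<le> 1 * ((hi - ?b) / mm)"
      using b hi[of i] mpos[of i] \<open>mm > 0\<close> \<open>mm \<le> hi\<close> by (intro mult_mono frac_le) auto
    also have "\<dots> \<le> 1 / mm * osc (level z)"
      using \<open>mm > 0\<close> by (auto simp: hi_def osc_def intro!: divide_right_mono)
    finally show "\<bar>(z - p) $ i\<bar> \<le> alpha_star pv sigma2 * osc (level z)"
      by (simp add: alpha_star_def mm_def)
  qed
  finally show ?thesis by simp
qed

end

section \<open>Convergence along a fixed sample path\<close>

context opinion_game
begin

context
  fixes z :: "nat \<Rightarrow> real ^ 'n" and \<kappa> :: "nat \<Rightarrow> 'n" and \<upsilon> :: "nat \<Rightarrow> real" and ws :: "'n list"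
  assumes z_0: "z 0 \<in> cube" and z_Suc: "\<And>t. z (Suc t) = br_step P sigma2 (z t) (\<kappa> t) (\<upsilon> t)"
    and \<upsilon>: "\<And>t. 0 \<le> \<upsilon> t" "\<And>t. \<upsilon> t < 1"
    and ws: "distinct ws" "set ws = UNIV"
    and ws_sorted: "\<And>r s. r < s \<Longrightarrow> s < length ws \<Longrightarrow> sigma2 $ (ws ! s) \<le> sigma2 $ (ws ! r)"
begin

lemma z_cube: "z t \<in> cube"
  by (induction t) (simp_all add: z_0 z_Suc br_step_in_cube \<upsilon>)

text \<open>The word lists the agents by decreasing variance, so each one it activates is at least as
  noisy as all agents that are still stubborn, and hence gives up her own stubbornness.\<close>

lemma nonstubborn_after_word:
  assumes word: "\<And>r. r < length ws \<Longrightarrow> \<kappa> (t + r) = ws ! r"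
  shows "z (t + length ws) $ i < 1"
proof -
  have "\<forall>s<r. z (t + r) $ (ws ! s) < 1" if "r \<le> length ws" for r
    using that
  proof (induction r)
    case (Suc r)
    let ?k = "ws ! r"
    have z': "z (t + Suc r) = br_step P sigma2 (z (t + r)) ?k (\<upsilon> (t + r))"
      using word[of r] Suc.prems by (simp add: z_Suc)
    have "z (t + Suc r) $ ?k < 1"
      unfolding z'
    proof (rule br_step_lt_1[OF z_cube \<upsilon>])
      fix j assume j: "j \<noteq> ?k" "z (t + r) $ j = 1"
      obtain s where s: "s < length ws" "ws ! s = j" using ws(2) by (metis UNIV_I in_set_conv_nth)
      then have "\<not> s < r" using Suc j by auto
      then have "r < s" using s j by (metis linorder_neqE_nat)
      then show "sigma2 $ j \<le> sigma2 $ ?k" using ws_sorted s by blast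
    qed
    moreover have "z (t + Suc r) $ (ws ! s) < 1" if "s < r" for s
    proof -
      have "ws ! s \<noteq> ?k" using ws(1) that Suc.prems by (simp add: nth_eq_iff_index_eq)
      then show ?thesis unfolding z' using Suc that by (simp add: br_step_other)
    qed
    ultimately show ?case by (auto simp: less_Suc_eq)
  qed simp
  moreover obtain s where "s < length ws" "ws ! s = i" using ws(2) by (metis UNIV_I in_set_conv_nth)
  ultimately show ?thesis by blast
qed

text \<open>With nobody stubborn, the premise of \<open>br_step_lt_1\<close> about stubborn agents
  is vacuous.\<close>

lemma nonstubborn_forever:
  assumes "\<And>i. z t $ i < 1"
  shows "z (t + r) $ i < 1"
proof (induction r arbitrary: i)
  case (Suc r)
  then have "z (Suc (t + r)) $ \<kappa> (t + r) < 1"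
    unfolding z_Suc by (intro br_step_lt_1[OF z_cube \<upsilon>]) (metis less_irrefl)
  then show ?case using Suc by (cases "i = \<kappa> (t + r)") (simp_all add: z_Suc br_step_other)
qed (simp add: assms)

lemma br_trajectory_tendsto:
  assumes inf: "\<exists>\<^sub>\<infinity>t. \<forall>r<length ws. \<kappa> (t + r) = ws ! r"
  shows "(\<lambda>t. infdist (z t) (Zstar pv sigma2)) \<longlonglongrightarrow> 0"
proof -
  obtain t0 where t0: "\<forall>r<length ws. \<kappa> (t0 + r) = ws ! r" using INFM_EX[OF inf] by blast
  \<comment> \<open>Time is restarted right after the first occurrence of the word, from where on
    levels are meaningful.\<close>
  define T where "T = t0 + length ws"
  have lt: "z (T + t) $ i < 1" for t i
    unfolding T_def by (rule nonstubborn_forever, rule nonstubborn_after_word) (use t0 in auto)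
  define \<beta> where "\<beta> t = level (z (T + t))" for t
  have "(\<lambda>t. osc (\<beta> t)) \<longlonglongrightarrow> 0"
  proof (cases "\<exists>k::'n. UNIV = {k}")
    \<comment> \<open>A single agent has nobody to average over, but her oscillation is 0 at all
      times.\<close>
    case True
    then obtain k where "UNIV = {k::'n}" by blast
    then have "i = k" for i by blast
    then have "osc (\<beta> t) \<le> \<beta> t k - \<beta> t k" for t by (intro osc_le) (metis order_refl)+
    then have "osc (\<beta> t) = 0" for t using osc_nonneg[of "\<beta> t"] by (simp add: order_antisym)
    then show ?thesis by simp
  next
    case False
    then have two: "\<exists>l. l \<noteq> k" for k :: 'n by blast
    let ?\<kappa> = "\<lambda>t. \<kappa> (T + t)" and ?A = "\<lambda>t. others_avg (z (T + t)) (\<kappa> (T + t))"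
    let ?m = "\<lambda>k. pv $ k * sigma2 $ k"
    have keep: "\<beta> (Suc t) j = \<beta> t j" if "j \<noteq> ?\<kappa> t" for t j
      using that by (simp add: \<beta>_def level_def mass_def z_Suc br_step_other)
    have new: "\<beta> (Suc t) (?\<kappa> t) = max (?m (?\<kappa> t)) (?A t)" for t
      using two[of "?\<kappa> t"] level_br_step[OF z_cube lt] by (auto simp: \<beta>_def z_Suc)
    have floor: "?m j \<le> \<beta> t j" for t j unfolding \<beta>_def by (rule level_ge[OF z_cube lt])
    have up: "?A t \<le> c" if "\<And>j. j \<noteq> ?\<kappa> t \<Longrightarrow> \<beta> t j \<le> c" for t c
      using two[of "?\<kappa> t"] others_avg_le[OF lt] that by (auto simp: \<beta>_def)
    \<comment> \<open>The largest initial level bounds all later ones, so one contraction constant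
      serves for all times.\<close>
    define C where "C = Max (range (\<beta> 0))"
    have C: "\<beta> t j \<le> C" for t j
    proof (induction t arbitrary: j)
      case 0 show ?case by (simp add: C_def)
    next
      case (Suc t)
      show ?case
      proof (cases "j = ?\<kappa> t")
        case True
        then show ?thesis using new[of t] up[of t C] Suc floor[of j t] order_trans[OF floor Suc] by simp
      qed (simp add: keep Suc)
    qed
    have "C > 0" using C[of 0] level_pos[OF lt] less_le_trans unfolding \<beta>_def by blast
    note \<delta> = weight_bound(1)[OF this] weight_bound(2)[of C]
    have down: "lo + weight_bound C * (c - lo) \<le> ?A t"
      if "\<And>j. j \<noteq> ?\<kappa> t \<Longrightarrow> lo \<le> \<beta> t j" "l \<noteq> ?\<kappa> t" "lo \<le> c" "c \<le> \<beta> t l" for t lo c l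
      using others_avg_ge[OF z_cube lt C[unfolded \<beta>_def]] that by (auto simp: \<beta>_def)
    have osc_dec: "osc (\<beta> (Suc t)) \<le> osc (\<beta> t)" for t
      by (rule word_contracts_osc(1)[where \<kappa> = ?\<kappa> and m = ?m and A = ?A]) (fact keep new floor up down \<delta> two)+
    have osc_word: "osc (\<beta> (t + length ws)) \<le> (1 - (weight_bound C)\<^sup>2 / 2) * osc (\<beta> t)"
      if "\<And>r. r < length ws \<Longrightarrow> ?\<kappa> (t + r) = ws ! r" for t
      by (rule word_contracts_osc(2)[where \<kappa> = ?\<kappa> and m = ?m and A = ?A])
         (fact keep new floor up down \<delta> two that ws)+
    show ?thesis
    proof (rule contracting_decseq_tendsto_0[where q = "1 - (weight_bound C)\<^sup>2 / 2" and N = "length ws"])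
      show "decseq (\<lambda>t. osc (\<beta> t))" by (rule decseq_SucI) (rule osc_dec)
      show "0 \<le> osc (\<beta> t)" for t by (rule osc_nonneg)
      show "1 - (weight_bound C)\<^sup>2 / 2 < 1" using \<delta> by simp
      show "\<exists>\<^sub>\<infinity>t. osc (\<beta> (t + length ws)) \<le> (1 - (weight_bound C)\<^sup>2 / 2) * osc (\<beta> t)"
        unfolding INFM_nat_le
      proof
        fix m
        \<comment> \<open>Late occurrences are taken so that the shifted time \<open>t - T\<close>
          is still at least \<open>m\<close>.\<close>
        obtain t where t: "t \<ge> T + m" "\<forall>r<length ws. \<kappa> (t + r) = ws ! r"
          using inf unfolding INFM_nat_le by blast
        have "osc (\<beta> (t - T + length ws)) \<le> (1 - (weight_bound C)\<^sup>2 / 2) * osc (\<beta> (t - T))"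
          by (rule osc_word) (use t in simp)
        then show "\<exists>t\<ge>m. osc (\<beta> (t + length ws)) \<le> (1 - (weight_bound C)\<^sup>2 / 2) * osc (\<beta> t)"
          using t by (intro exI[of _ "t - T"]) auto
      qed
    qed
  qed
  then have lim: "(\<lambda>t. real CARD('n) * alpha_star pv sigma2 * osc (\<beta> t)) \<longlonglongrightarrow> 0"
    by (rule tendsto_mult_right_zero)
  have "(\<lambda>t. infdist (z (T + t)) (Zstar pv sigma2)) \<longlonglongrightarrow> 0"
    by (rule Lim_null_comparison[OF _ lim])
       (auto simp: \<beta>_def infdist_nonneg intro!: always_eventually infdist_Zstar_le z_cube lt)
  then show ?thesis by (subst (asm) add.commute) (rule LIMSEQ_offset)
qed

end

end

section \<open>Almost sure recurrence of a finite word\<close>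

lemma (in prob_space) AE_word_infinitely_often:
  fixes X :: "nat \<Rightarrow> 'a \<Rightarrow> 'b" and ws :: "'k list" and N :: "'b measure" and f :: "'b \<Rightarrow> 'k"
  assumes indep: "indep_vars (\<lambda>_. N) X UNIV" and ws: "ws \<noteq> []"
    and f: "\<And>k. {x \<in> space N. f x = k} \<in> sets N"
    and p: "\<And>t k. prob {\<omega> \<in> space M. f (X t \<omega>) = k} = p" "p > 0"
  shows "AE \<omega> in M. \<exists>\<^sub>\<infinity>t. \<forall>r<length ws. f (X (t + r) \<omega>) = ws ! r"
proof -
  let ?n = "length ws"
  have n: "?n > 0" using ws by simp
  \<comment> \<open>Occurrences are only sought in consecutive disjoint blocks of times, which makes
    the events independent.\<close>
  define J where "J m = {m * ?n..<m * ?n + ?n}" for m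
  define hit where "hit m \<omega> \<longleftrightarrow> (\<forall>i\<in>J m. f (X i \<omega>) = ws ! (i - m * ?n))" for m \<omega>
  define E where "E m = {\<omega> \<in> space M. hit m \<omega>}" for m
  have disj: "disjoint_family_on J UNIV"
  proof -
    have "i div ?n = m" if "i \<in> J m" for i m
      using that n by (intro div_nat_eqI) (auto simp: J_def mult.commute)
    then show ?thesis unfolding disjoint_family_on_def by blast
  qed
  have X: "X t \<in> measurable M N" for t using indep by (simp add: indep_vars_def)
  have ev: "{\<omega> \<in> space M. f (X t \<omega>) = k} = X t -` {x \<in> space N. f x = k} \<inter> space M" for t k
    using measurable_space[OF X] by auto
  \<comment> \<open>Grouping independent variables by blocks yields their restrictions to
    \<open>J m\<close>; inside the block the restriction is invisible, and the event is
    \<open>hit m\<close>.\<close>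
  have "indep_events (\<lambda>m. {\<omega> \<in> space M. \<forall>i\<in>J m. f (restrict (\<lambda>i. X i \<omega>) (J m) i) = ws ! (i - m * ?n)}) UNIV"
  proof (rule indep_eventsI_indep_vars[OF indep_vars_restrict[OF indep _ disj]])
    fix m
    have "{x \<in> space (PiM (J m) (\<lambda>_. N)). \<forall>i\<in>J m. f (x i) = ws ! (i - m * ?n)}
        = PiE (J m) (\<lambda>i. {x \<in> space N. f x = ws ! (i - m * ?n)})"
      by (auto simp: space_PiM PiE_iff extensional_def)
    also have "\<dots> \<in> sets (PiM (J m) (\<lambda>_. N))"
      by (rule sets_PiM_I_finite) (auto simp: f J_def)
    finally show "{x \<in> space (PiM (J m) (\<lambda>_. N)). \<forall>i\<in>J m. f (x i) = ws ! (i - m * ?n)}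
        \<in> sets (PiM (J m) (\<lambda>_. N))" .
  qed auto
  then have ind: "indep_events (\<lambda>m. {\<omega> \<in> space M. hit m \<omega>}) UNIV" by (simp add: hit_def)
  then have E_ev [measurable]: "E m \<in> events" for m by (auto simp: indep_events_def E_def)
  have prob_E: "prob (E m) = p ^ ?n" for m
  proof -
    have "E m = (\<Inter>i\<in>J m. X i -` {x \<in> space N. f x = ws ! (i - m * ?n)} \<inter> space M)"
      using n by (auto simp: E_def hit_def J_def dest: measurable_space[OF X])
    then have "prob (E m) = (\<Prod>i\<in>J m. prob (X i -` {x \<in> space N. f x = ws ! (i - m * ?n)} \<inter> space M))"
      using n by (simp only:) (intro indep_varsD[OF indep], auto simp: J_def f)
    then show ?thesis unfolding ev[symmetric] p by (simp add: J_def)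
  qed
  \<comment> \<open>Almost surely finitely many hits would send the probability of a hit from block
    \<open>k\<close> on to 0, by continuity from above, yet it is at least \<open>p ^ ?n\<close>.
    The 0-1 law then leaves only infinitely many hits.\<close>
  have "\<not> (AE \<omega> in M. finite {m. hit m \<omega>})"
  proof
    assume fin: "AE \<omega> in M. finite {m. hit m \<omega>}"
    let ?D = "\<lambda>k. \<Union>m\<in>{k..}. E m"
    have "decseq ?D" by (rule decseq_SucI) (force intro: Suc_leD)
    then have "(\<lambda>k. prob (?D k)) \<longlonglongrightarrow> prob (\<Inter>k. ?D k)"
      by (intro finite_Lim_measure_decseq) auto
    moreover have "prob (\<Inter>k. ?D k) = 0"
    proof (subst prob_eq_0)
      show "AE \<omega> in M. \<omega> \<notin> (\<Inter>k. ?D k)"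
        using fin
      proof eventually_elim
        case (elim \<omega>)
        then obtain b where "\<And>m. hit m \<omega> \<Longrightarrow> m < b" by (auto simp: finite_nat_set_iff_bounded)
        then have "\<omega> \<notin> ?D b" by (fastforce simp: E_def)
        then show ?case by blast
      qed
    qed measurable
    moreover have "p ^ ?n \<le> prob (?D k)" for k
      unfolding prob_E[of k, symmetric] by (intro finite_measure_mono) auto
    ultimately have "p ^ ?n \<le> 0" by (metis (no_types, lifting) LIMSEQ_le_const)
    with zero_less_power[OF p(2), of ?n] show False by simp
  qed
  with borel_0_1_law_AE[OF ind] have "AE \<omega> in M. infinite {m. hit m \<omega>}" by blast
  then show ?thesis
  proof eventually_elim
    case (elim \<omega>)
    show ?case unfolding INFM_nat_le
    proof
      fix k
      obtain m where m: "m \<ge> k" "hit m \<omega>" using elim by (auto simp: infinite_nat_iff_unbounded_le)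
      have "k \<le> m * ?n" using m n by (metis le_trans mult.right_neutral mult_le_mono2 Suc_leI One_nat_def)
      moreover have "\<forall>r<?n. f (X (m * ?n + r) \<omega>) = ws ! r" using m(2) by (auto simp: hit_def J_def)
      ultimately show "\<exists>t\<ge>k. \<forall>r<?n. f (X (t + r) \<omega>) = ws ! r" by blast
    qed
  qed
qed

section \<open>From sample paths to almost sure convergence\<close>

theorem theorem3:
  fixes M :: "'w measure"
    and P :: "real ^ 'n ^ 'n" and pv sigma2 :: "real ^ 'n::finite"
    and Z0 :: "'w \<Rightarrow> real ^ 'n" and K :: "nat \<Rightarrow> 'w \<Rightarrow> 'n" and U :: "nat \<Rightarrow> 'w \<Rightarrow> real"
  assumes "prob_space M"
    and "row_stochastic P" and "irreducible_mat P" and "aperiodic_mat P"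
    and "\<forall>i. pv $ i \<ge> 0" and "(\<Sum>i\<in>UNIV. pv $ i) = 1" and "transpose P *v pv = pv"
    and "\<forall>i. sigma2 $ i > 0"
    and "Z0 \<in> borel_measurable M"
    and "\<forall>\<omega>\<in>space M. \<forall>i. 0 \<le> Z0 \<omega> $ i \<and> Z0 \<omega> $ i \<le> 1"
    and "\<And>t. distr M (count_space UNIV \<Otimes>\<^sub>M lborel) (\<lambda>\<omega>. (K t \<omega>, U t \<omega>))
               = uniform_count_measure UNIV \<Otimes>\<^sub>M uniform_measure lborel {0..1}"
    and "prob_space.indep_vars M (\<lambda>_. count_space UNIV \<Otimes>\<^sub>M lborel) (\<lambda>t \<omega>. (K t \<omega>, U t \<omega>)) UNIV"
    and "prob_space.indep_set M (sets (vimage_algebra (space M) Z0 borel))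
           (sets (vimage_algebra (space M) (\<lambda>\<omega> t. (K t \<omega>, U t \<omega>))
              (PiM UNIV (\<lambda>_::nat. count_space UNIV \<Otimes>\<^sub>M lborel))))"
  shows "AE \<omega> in M. ((\<lambda>t. infdist (br_dyn P sigma2 Z0 K U t \<omega>) (Zstar pv sigma2)) \<longlonglongrightarrow> 0)"
proof -
  interpret prob_space M by (rule assms(1))
  interpret opinion_game P pv sigma2 by unfold_locales (use assms(2-8) in auto)
  let ?N = "count_space (UNIV :: 'n set) \<Otimes>\<^sub>M (lborel :: real measure)"
  let ?X = "\<lambda>t \<omega>. (K t \<omega>, U t \<omega>)"
  let ?unif = "uniform_measure lborel {0..1::real}"
  have X [measurable]: "?X t \<in> measurable M ?N" for t using assms(12) by (simp add: indep_vars_def)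
  interpret unif: prob_space ?unif by (rule prob_space_uniform_measure) auto
  \<comment> \<open>The joint law on rectangles; \<open>A = UNIV\<close> and \<open>B = UNIV\<close>
    give the laws of \<open>U t\<close> and \<open>K t\<close>.\<close>
  have em: "emeasure M {\<omega> \<in> space M. K t \<omega> \<in> A \<and> U t \<omega> \<in> B} = emeasure (uniform_count_measure UNIV) A * emeasure ?unif B"
    if [measurable]: "B \<in> sets borel" for t A B
  proof -
    have "emeasure M {\<omega> \<in> space M. K t \<omega> \<in> A \<and> U t \<omega> \<in> B} = emeasure (distr M ?N (?X t)) (A \<times> B)"
      by (subst emeasure_distr) (auto intro!: arg_cong[where f = "emeasure M"])
    also have "\<dots> = emeasure (uniform_count_measure UNIV) A * emeasure ?unif B"
      unfolding assms(11) by (rule unif.emeasure_pair_measure_Times) (auto simp: sets_uniform_count_measure)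
    finally show ?thesis .
  qed
  have U: "AE \<omega> in M. 0 \<le> U t \<omega> \<and> U t \<omega> < 1" for t
  proof (rule AE_I)
    show "{\<omega> \<in> space M. \<not> (0 \<le> U t \<omega> \<and> U t \<omega> < 1)} \<subseteq> {\<omega> \<in> space M. K t \<omega> \<in> UNIV \<and> U t \<omega> \<in> - {0..<1}}" by auto
    \<comment> \<open>Only the endpoint 1 has to be discarded, which is a null set; there a draw
      could return stubbornness.\<close>
    have "{0..1::real} \<inter> - {0..<1} = {1}" by auto
    then show "emeasure M {\<omega> \<in> space M. K t \<omega> \<in> UNIV \<and> U t \<omega> \<in> - {0..<1}} = 0"
      by (subst em) simp_all
    have "{\<omega> \<in> space M. K t \<omega> \<in> UNIV \<and> U t \<omega> \<in> - {0..<1}} = ?X t -` (UNIV \<times> - {0..<1}) \<inter> space M" by auto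
    also have "\<dots> \<in> events" by measurable
    finally show "{\<omega> \<in> space M. K t \<omega> \<in> UNIV \<and> U t \<omega> \<in> - {0..<1}} \<in> events" .
  qed
  have pK: "prob {\<omega> \<in> space M. fst (?X t \<omega>) = k} = 1 / real CARD('n)" for t k
    using em[of UNIV t "{k}"] unif.emeasure_space_1
    by (simp add: measure_def emeasure_uniform_count_measure)
  obtain us where us: "set us = (UNIV :: 'n set)" "distinct us" using finite_distinct_list[OF finite] by blast
  \<comment> \<open>Sorting is increasing, so negated variances as keys list the agents by
    decreasing variance.\<close>
  define ws where "ws = sort_key (\<lambda>i. - sigma2 $ i) us"
  have ws: "distinct ws" "set ws = UNIV" by (simp_all add: ws_def us)
  have sorted: "sigma2 $ (ws ! s) \<le> sigma2 $ (ws ! r)" if "r < s" "s < length ws" for r s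
    using sorted_nth_mono[of "map (\<lambda>i. - sigma2 $ i) ws" r s] that by (simp add: ws_def)
  have "AE \<omega> in M. \<exists>\<^sub>\<infinity>t. \<forall>r<length ws. fst (?X (t + r) \<omega>) = ws ! r"
  proof (rule AE_word_infinitely_often[OF assms(12) _ _ pK])
    show "ws \<noteq> []" using ws by auto
    have "{x \<in> space ?N. fst x = k} = {k} \<times> UNIV" for k by (auto simp: space_pair_measure)
    then show "{x \<in> space ?N. fst x = k} \<in> sets ?N" for k by simp
  qed simp
  moreover have "AE \<omega> in M. \<forall>t. 0 \<le> U t \<omega> \<and> U t \<omega> < 1" using U by (simp add: AE_all_countable)
  ultimately show ?thesis
    using AE_space
  proof eventually_elim
    case (elim \<omega>)
    show ?case
      by (rule br_trajectory_tendsto[where \<kappa> = "\<lambda>t. K t \<omega>" and \<upsilon> = "\<lambda>t. U t \<omega>" and ws = ws])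
         (use elim assms(10) ws sorted in \<open>auto simp: cube_def\<close>)
  qed
qed

end
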